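(* Let $\varepsilon\le\frac13$, $\kappa>0$, $\delta\in(0,1)$. Let $\min_{x\in\mathcal{P}}h_{p^*}(x)$ be the fractional version of a distributionally robust 2-stage problem satisfying properties (P1)–(P6), and let $LB>0$ be a lower bound on $\min_{x\in\mathcal{P}}h_p(x)$ for every distribution $p$. There is a sample size $N$, polynomial in $\frac{\lambda}{\varepsilon}$, $\log(\frac{\tau R}{V\cdot LB})$ and $\log(\frac1\delta)$, such that the following holds. Let $k=\frac2\varepsilon\log(\frac1\delta)$ and for $i=1,\dots,k$ let $\hat p^i$ be the empirical distribution of $N$ independent samples from $p^*$. Suppose that for every $i$ we have $\bar x^i\in\mathcal{P}$ and $\bar f^i$ with $h_{\hat p^i}(\bar x^i)\le\bar\beta\bar f^i$ and $\bar f^i\le\rho\min_{x\in\mathcal{P}}h_{\hat p^i}(x)$, where $\bar\beta,\rho\ge1$. Let $j=\arg\min_i\bar f^i$ and $\bar x=\bar x^j$. Then with probability at least $1-3\delta$, $h_{p^*}(\bar x)\le4\bar\beta\rho(1+O(\varepsilon))\min_{x\in\mathcal{P}}h_{p^*}(x)$.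
   Context: $\mathcal{A}$ finite set of scenarios; $\mathcal{P}\subseteq\mathbb{R}^m_{\ge0}$ a polytope, $X=\mathcal{P}\cap\mathbb{Z}^m$; $c\in\mathbb{R}^m$; $g(x,A)\ge0$ the optimal fractional second-stage cost of $A$ given $x\in\mathcal{P}$. $\kappa_{sc}$ is a scenario metric ($\kappa_{sc}(A,A)=0$), $r>0$. For a distribution $p$: $z_p(x)=\max\{\sum_{A,A'}\gamma_{A,A'}g(x,A'):\gamma\ge0,\ \sum_{A'}\gamma_{A,A'}\le p_A\ \forall A,\ \sum_{A,A'}\kappa_{sc}(A,A')\gamma_{A,A'}\le r\}$, $h_p(x)=c^\top x+z_p(x)$. $p^*$ is accessed only via independent samples; $\mathcal{I}$ is the input size. (P1) $0\in X$, $c\ge0$, $\log|X|$ polynomial in $\mathcal{I}$, $0\le g(x,A)\le g(0,A)$. (P2) $g(0,A)\le g(x,A)+\lambda c^\top x$ for known $\lambda\ge1$. (P3) known $R$, $V\le1$: $\mathcal{P}\subseteq\{\|x\|_2\le R\}$, $\mathcal{P}$ contains a ball of radius $V$, $\ln(R/V)$ polynomial in $\mathcal{I}$. (P4) $g(\cdot,A)$ convex on $\mathcal{P}$, efficiently computable. (P5) subgradients of $g(\cdot,A)$ of norm $\le K$ efficiently computable, $\ln K$ polynomial in $\mathcal{I}$. (P6) known $\tau\ge1$, $\ln\tau$ polynomial in $\mathcal{I}$, with $g(x,A')-g(x,A)\le\tau\kappa_{sc}(A,A')$ whenever $\kappa_{sc}(A,A')>0$.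
   Formalization: The sample size N is polynomial in the input size I (which bounds m, ln K, etc.) as well as in λ/ε, log(τR/(V·LB)) and log(1/δ), since without I the claim fails; ε>0 is assumed and k is rounded up. *)

theory Defs
  imports
    "HOL-Probability.Probability"
    "HOL-Computational_Algebra.Polynomial"
    "Jordan_Normal_Form.Matrix"
begin

no_notation inner (infix \<open>\<bullet>\<close> 70)
no_notation vec_nth (infixl \<open>$\<close> 90)

text \<open>
  The dimension \<open>m\<close> is universally quantified inside the theorem, below the constants and the
  sample-size function, which must not depend on it.  Points of $R^m$ are therefore
  elements of \<^term>\<open>carrier_vec m :: real vec set\<close> rather than of a type-indexed space.
\<close>

definition norm2 :: "real vec \<Rightarrow> real" where
  "norm2 x = sqrt (x \<bullet> x)"

definition polytope_in :: "nat \<Rightarrow> real vec set \<Rightarrow> bool" where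
  "polytope_in m P \<longleftrightarrow>
     (\<exists>n. \<exists>M \<in> carrier_mat n m. \<exists>b \<in> carrier_vec n. P = {x \<in> carrier_vec m. M *\<^sub>v x \<le> b}) \<and>
     (\<exists>B. \<forall>x\<in>P. norm2 x \<le> B)"

definition integer_points :: "real vec set \<Rightarrow> real vec set" where
  "integer_points P = {x \<in> P. \<forall>i < dim_vec x. x $ i \<in> \<int>}"

definition convex_fun_on :: "real vec set \<Rightarrow> (real vec \<Rightarrow> real) \<Rightarrow> bool" where
  "convex_fun_on P f \<longleftrightarrow>
     (\<forall>x\<in>P. \<forall>y\<in>P. \<forall>u\<ge>0. \<forall>v\<ge>0. u + v = 1 \<longrightarrow> f (u \<cdot>\<^sub>v x + v \<cdot>\<^sub>v y) \<le> u * f x + v * f y)"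

definition subgradient_on :: "nat \<Rightarrow> real vec set \<Rightarrow> (real vec \<Rightarrow> real) \<Rightarrow> real vec \<Rightarrow> real vec \<Rightarrow> bool" where
  "subgradient_on m P f x d \<longleftrightarrow> d \<in> carrier_vec m \<and> (\<forall>y\<in>P. f x + d \<bullet> (y - x) \<le> f y)"

definition transport_plans ::
    "'a set \<Rightarrow> ('a \<Rightarrow> 'a \<Rightarrow> real) \<Rightarrow> real \<Rightarrow> 'a pmf \<Rightarrow> ('a \<Rightarrow> 'a \<Rightarrow> real) set" where
  "transport_plans \<A> \<kappa>sc r p =
     {\<gamma>. (\<forall>A\<in>\<A>. \<forall>A'\<in>\<A>. 0 \<le> \<gamma> A A') \<and>
         (\<forall>A\<in>\<A>. (\<Sum>A'\<in>\<A>. \<gamma> A A') \<le> pmf p A) \<and>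
         (\<Sum>A\<in>\<A>. \<Sum>A'\<in>\<A>. \<kappa>sc A A' * \<gamma> A A') \<le> r}"

definition z_val ::
    "'a set \<Rightarrow> (real vec \<Rightarrow> 'a \<Rightarrow> real) \<Rightarrow> ('a \<Rightarrow> 'a \<Rightarrow> real) \<Rightarrow> real \<Rightarrow> 'a pmf \<Rightarrow> real vec \<Rightarrow> real" where
  "z_val \<A> g \<kappa>sc r p x =
     (SUP \<gamma> \<in> transport_plans \<A> \<kappa>sc r p. \<Sum>A\<in>\<A>. \<Sum>A'\<in>\<A>. \<gamma> A A' * g x A')"

definition h_val ::
    "'a set \<Rightarrow> real vec \<Rightarrow> (real vec \<Rightarrow> 'a \<Rightarrow> real) \<Rightarrow> ('a \<Rightarrow> 'a \<Rightarrow> real) \<Rightarrow> real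
      \<Rightarrow> 'a pmf \<Rightarrow> real vec \<Rightarrow> real" where
  "h_val \<A> c g \<kappa>sc r p x = c \<bullet> x + z_val \<A> g \<kappa>sc r p x"

text \<open>
  An instance of input size \<open>sz\<close>.  The single polynomial \<open>q\<close> witnesses all the bounds
  ``polynomial in the input size''; since the input lists the cost vector \<open>c\<close>, the dimension
  is at most \<open>sz\<close>.  The scenario metric may be asymmetric and may vanish off the
  diagonal, and no triangle inequality is required.
\<close>

locale dr_two_stage =
  fixes \<A> :: "'a set" and m :: nat and P :: "real vec set" and c :: "real vec"
    and g :: "real vec \<Rightarrow> 'a \<Rightarrow> real" and \<kappa>sc :: "'a \<Rightarrow> 'a \<Rightarrow> real" and r :: real
    and lam R V K \<tau> :: real and sz :: nat and q :: "real poly"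
  assumes finite_scenarios: "finite \<A>"
    and dim_le_size: "m \<le> sz"
    and polytope: "polytope_in m P"
    and P_nonneg: "\<And>x. x \<in> P \<Longrightarrow> 0\<^sub>v m \<le> x"
    and c_carrier: "c \<in> carrier_vec m"
    and metric_nonneg: "\<And>A A'. A \<in> \<A> \<Longrightarrow> A' \<in> \<A> \<Longrightarrow> 0 \<le> \<kappa>sc A A'"
    and metric_refl: "\<And>A. A \<in> \<A> \<Longrightarrow> \<kappa>sc A A = 0"
    and r_pos: "0 < r"
    and P1_zero: "0\<^sub>v m \<in> integer_points P"
    and P1_c: "0\<^sub>v m \<le> c"
    and P1_card: "ln (real (card (integer_points P))) \<le> poly q (real sz)"
    and P1_g: "\<And>x A. x \<in> P \<Longrightarrow> A \<in> \<A> \<Longrightarrow> 0 \<le> g x A \<and> g x A \<le> g (0\<^sub>v m) A"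
    and P2_lambda: "1 \<le> lam"
    and P2: "\<And>x A. x \<in> P \<Longrightarrow> A \<in> \<A> \<Longrightarrow> g (0\<^sub>v m) A \<le> g x A + lam * (c \<bullet> x)"
    and P3_V: "0 < V" "V \<le> 1"
    and P3_outer: "\<And>x. x \<in> P \<Longrightarrow> norm2 x \<le> R"
    and P3_inner: "\<exists>a \<in> carrier_vec m. {x \<in> carrier_vec m. norm2 (x - a) \<le> V} \<subseteq> P"
    and P3_size: "ln (R / V) \<le> poly q (real sz)"
    and P4: "\<And>A. A \<in> \<A> \<Longrightarrow> convex_fun_on P (\<lambda>x. g x A)"
    and P5_K: "0 < K"
    and P5: "\<And>x A. x \<in> P \<Longrightarrow> A \<in> \<A> \<Longrightarrow>
               \<exists>d. subgradient_on m P (\<lambda>y. g y A) x d \<and> norm2 d \<le> K"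
    and P5_size: "ln K \<le> poly q (real sz)"
    and P6_tau: "1 \<le> \<tau>"
    and P6: "\<And>x A A'. x \<in> P \<Longrightarrow> A \<in> \<A> \<Longrightarrow> A' \<in> \<A> \<Longrightarrow> 0 < \<kappa>sc A A' \<Longrightarrow>
               g x A' - g x A \<le> \<tau> * \<kappa>sc A A'"
    and P6_size: "ln \<tau> \<le> poly q (real sz)"

text \<open>\<open>k\<close> independent batches of \<open>N\<close> independent samples; \<open>\<omega> (i, l)\<close> is sample \<open>l\<close> of batch \<open>i\<close>.\<close>

definition sample_batches :: "nat \<Rightarrow> nat \<Rightarrow> 'a pmf \<Rightarrow> (nat \<times> nat \<Rightarrow> 'a) pmf" where
  "sample_batches k N p = Pi_pmf ({1..k} \<times> {1..N}) undefined (\<lambda>_. p)"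

definition empirical :: "nat \<Rightarrow> (nat \<times> nat \<Rightarrow> 'a) \<Rightarrow> nat \<Rightarrow> 'a pmf" where
  "empirical N \<omega> i = map_pmf (\<lambda>l. \<omega> (i, l)) (pmf_of_set {1..N})"

text \<open>
  For nonnegative arguments, being bounded by a polynomial in several quantities is the same as
  being bounded by \<open>a * (1 + their sum) ^ d\<close>.  The second argument will be a logarithm, which may
  be negative and then contributes nothing to the bound.
\<close>

definition poly_sample_size :: "(real \<Rightarrow> real \<Rightarrow> real \<Rightarrow> nat \<Rightarrow> nat) \<Rightarrow> bool" where
  "poly_sample_size N \<longleftrightarrow>
     (\<exists>a d. \<forall>s\<ge>0. \<forall>t. \<forall>u\<ge>0. \<forall>n.
        1 \<le> N s t u n \<and> real (N s t u n) \<le> a * (1 + s + max 0 t + u + real n) ^ d)"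

end

theory Submission
  imports Defs
begin

text \<open>
  For a cost function \<open>u\<close> on scenarios, linear programming duality for the single budget constraint gives
  \<open>z\<^sub>p = min\<^bsub>y \<ge> 0\<^esub> r y + E\<^sub>p max\<^bsub>A'\<^esub> (u A' - y \<kappa>sc A A')\<close>.  Let \<open>O1\<close> slightly exceed the optimum, let
  \<open>x0\<close> have true cost at most \<open>O1\<close>, and call a scenario expensive if \<open>g 0 A > lam O1 / \<epsilon>\<close>.

  The value \<open>z\<^sub>p\<close> is concave in \<open>p\<close>, so the expected empirical cost of \<open>x0\<close> is at most \<open>O1\<close>.  By Markov's
  inequality a batch overestimates it by a factor \<open>1 + \<epsilon>\<close> with probability at most \<open>1 / (1 + \<epsilon>)\<close>, and with
  probability \<open>1 - \<delta>\<close> some batch does not.  Hence the selected \<open>x\<close> has empirical cost at most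
  \<open>\<beta> \<rho> (1 + \<epsilon>) O1\<close> in its own batch.

  The expensive scenarios contribute at most \<open>(1 + O(\<epsilon>)) O1\<close> to the true cost of any \<open>x\<close>.  If the other costs
  alone are kept, the function inside the expectation is bounded by \<open>lam O1 / \<epsilon>\<close>; Hoeffding's inequality and
  a union bound over batches and over nets of points \<open>x\<close> and multipliers \<open>y\<close> show that the true value exceeds
  the empirical one by at most \<open>4 \<epsilon> O1\<close>.  Altogether the true cost is at most \<open>\<beta> \<rho> (2 + O(\<epsilon>))\<close> times the optimum.
\<close>

section \<open>Transport values and their dual\<close>

definition plan_value :: "'a set \<Rightarrow> ('a \<Rightarrow> real) \<Rightarrow> ('a \<Rightarrow> 'a \<Rightarrow> real) \<Rightarrow> real" where
  "plan_value \<A> u \<gamma> = (\<Sum>A\<in>\<A>. \<Sum>A'\<in>\<A>. \<gamma> A A' * u A')"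

text \<open>A cost function \<open>u\<close> stands in for \<open>g x\<close> because the argument
  also needs truncated costs, which need not be the costs of any point.\<close>

definition transport_value ::
    "'a set \<Rightarrow> ('a \<Rightarrow> 'a \<Rightarrow> real) \<Rightarrow> real \<Rightarrow> 'a pmf \<Rightarrow> ('a \<Rightarrow> real) \<Rightarrow> real" where
  "transport_value \<A> d r p u = (SUP \<gamma> \<in> transport_plans \<A> d r p. plan_value \<A> u \<gamma>)"

text \<open>A c-transform of \<open>u\<close> for the transport cost \<open>y * d\<close>: for
  nonnegative \<open>u\<close>, the dual price of a unit of mass at \<open>A\<close> when a unit of
  budget costs \<open>y\<close>.\<close>

definition penalized ::
    "'a set \<Rightarrow> ('a \<Rightarrow> 'a \<Rightarrow> real) \<Rightarrow> real \<Rightarrow> ('a \<Rightarrow> real) \<Rightarrow> 'a \<Rightarrow> real" where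
  "penalized \<A> d y u A = Max ((\<lambda>A'. u A' - y * d A A') ` \<A>)"

lemma z_val_eq_transport_value: "z_val \<A> g d r p x = transport_value \<A> d r p (g x)"
  by (simp add: z_val_def transport_value_def plan_value_def)

locale transport =
  fixes \<A> :: "'a set" and d :: "'a \<Rightarrow> 'a \<Rightarrow> real"
  assumes finite_A: "finite \<A>"
    and nonempty_A: "\<A> \<noteq> {}"
    and d_nonneg: "\<And>A A'. A \<in> \<A> \<Longrightarrow> A' \<in> \<A> \<Longrightarrow> 0 \<le> d A A'"
    and d_refl: "\<And>A. A \<in> \<A> \<Longrightarrow> d A A = 0"
begin

section \<open>Elementary bounds on penalized costs\<close>

lemma penalized_ge: "A' \<in> \<A> \<Longrightarrow> u A' - y * d A A' \<le> penalized \<A> d y u A"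
  unfolding penalized_def using finite_A by (intro Max_ge) auto

lemma penalized_leI:
  assumes "\<And>A'. A' \<in> \<A> \<Longrightarrow> u A' - y * d A A' \<le> b"
  shows "penalized \<A> d y u A \<le> b"
  unfolding penalized_def using finite_A nonempty_A assms by (subst Max_le_iff) auto

lemma penalized_attained:
  obtains A' where "A' \<in> \<A>" "penalized \<A> d y u A = u A' - y * d A A'"
proof -
  have "penalized \<A> d y u A \<in> (\<lambda>A'. u A' - y * d A A') ` \<A>"
    unfolding penalized_def using finite_A nonempty_A by (intro Max_in) auto
  then show ?thesis using that by auto
qed

text \<open>Mass may stay at \<open>A\<close> without using budget, because
  \<open>d A A = 0\<close>.\<close>

lemma penalized_nonneg:
  assumes "A \<in> \<A>" "0 \<le> u A"
  shows "0 \<le> penalized \<A> d y u A"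
  using penalized_ge[OF assms(1), of u y A] d_refl[OF assms(1)] assms by simp

lemma penalized_le_bound:
  assumes "A \<in> \<A>" "0 \<le> y" "\<And>A'. A' \<in> \<A> \<Longrightarrow> u A' \<le> b"
  shows "penalized \<A> d y u A \<le> b"
proof (rule penalized_leI)
  fix A' assume "A' \<in> \<A>"
  then show "u A' - y * d A A' \<le> b"
    using assms(3)[of A'] mult_nonneg_nonneg[OF assms(2) d_nonneg[OF assms(1), of A']] by simp
qed

lemma penalized_antimono:
  assumes "A \<in> \<A>" "y \<le> y'"
  shows "penalized \<A> d y' u A \<le> penalized \<A> d y u A"
proof (rule penalized_leI)
  fix A' assume A': "A' \<in> \<A>"
  then have "y * d A A' \<le> y' * d A A'"
    using d_nonneg[OF assms(1) A'] assms(2) by (intro mult_right_mono) auto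
  then show "u A' - y' * d A A' \<le> penalized \<A> d y u A"
    using penalized_ge[OF A', of u y A] by linarith
qed

lemma penalized_perturb:
  assumes "\<And>A'. A' \<in> \<A> \<Longrightarrow> u A' \<le> v A' + e"
  shows "penalized \<A> d y u A \<le> penalized \<A> d y v A + e"
proof (rule penalized_leI)
  fix A' assume A': "A' \<in> \<A>"
  then show "u A' - y * d A A' \<le> penalized \<A> d y v A + e"
    using assms[OF A'] penalized_ge[OF A', of v y A] by linarith
qed

section \<open>Weak duality and monotonicity of transport values\<close>

lemma zero_plan: "0 \<le> r \<Longrightarrow> (\<lambda>_ _. 0) \<in> transport_plans \<A> d r p"
  by (simp add: transport_plans_def)

text \<open>Weak duality: a unit of mass sent from \<open>A\<close> to \<open>A'\<close> earns at
  most the price of \<open>A\<close> plus \<open>y * d A A'\<close>. The row constraints bound the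
  first part, the budget the second. A row may use less than \<open>pmf p A\<close>, so prices must
  be nonnegative, which \<open>u \<ge> 0\<close> ensures.\<close>

lemma plan_value_le_dual:
  assumes \<gamma>: "\<gamma> \<in> transport_plans \<A> d r p" and u: "\<And>A. A \<in> \<A> \<Longrightarrow> 0 \<le> u A" and y: "0 \<le> y"
  shows "plan_value \<A> u \<gamma> \<le> r * y + (\<Sum>A\<in>\<A>. pmf p A * penalized \<A> d y u A)"
proof -
  have nn: "0 \<le> \<gamma> A A'" if "A \<in> \<A>" "A' \<in> \<A>" for A A'
    using \<gamma> that by (auto simp: transport_plans_def)
  have "plan_value \<A> u \<gamma>
      \<le> (\<Sum>A\<in>\<A>. \<Sum>A'\<in>\<A>. \<gamma> A A' * penalized \<A> d y u A + y * (d A A' * \<gamma> A A'))"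
    unfolding plan_value_def
  proof (intro sum_mono)
    fix A A' assume A: "A \<in> \<A>" "A' \<in> \<A>"
    have "\<gamma> A A' * u A' \<le> \<gamma> A A' * (penalized \<A> d y u A + y * d A A')"
      using penalized_ge[OF A(2), of u y A] by (intro mult_left_mono nn A) auto
    then show "\<gamma> A A' * u A' \<le> \<gamma> A A' * penalized \<A> d y u A + y * (d A A' * \<gamma> A A')"
      by (simp add: algebra_simps)
  qed
  also have "\<dots> = (\<Sum>A\<in>\<A>. (\<Sum>A'\<in>\<A>. \<gamma> A A') * penalized \<A> d y u A)
      + y * (\<Sum>A\<in>\<A>. \<Sum>A'\<in>\<A>. d A A' * \<gamma> A A')"
    by (simp add: sum.distrib sum_distrib_left sum_distrib_right)
  also have "\<dots> \<le> (\<Sum>A\<in>\<A>. pmf p A * penalized \<A> d y u A) + y * r"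
    using \<gamma> y
    by (intro add_mono sum_mono mult_right_mono mult_left_mono penalized_nonneg u)
       (auto simp: transport_plans_def)
  finally show ?thesis by (simp add: mult.commute)
qed

lemma bdd_above_plan_values:
  assumes "\<And>A. A \<in> \<A> \<Longrightarrow> 0 \<le> u A"
  shows "bdd_above (plan_value \<A> u ` transport_plans \<A> d r p)"
  using assms
  by (intro bdd_aboveI2[where M = "r * 0 + (\<Sum>A\<in>\<A>. pmf p A * penalized \<A> d 0 u A)"]
      plan_value_le_dual) auto

lemma plan_value_le_transport_value:
  assumes "\<gamma> \<in> transport_plans \<A> d r p" "\<And>A. A \<in> \<A> \<Longrightarrow> 0 \<le> u A"
  shows "plan_value \<A> u \<gamma> \<le> transport_value \<A> d r p u"
  unfolding transport_value_def using assms by (intro cSUP_upper bdd_above_plan_values)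

lemma transport_value_leI:
  assumes "0 \<le> r" "\<And>\<gamma>. \<gamma> \<in> transport_plans \<A> d r p \<Longrightarrow> plan_value \<A> u \<gamma> \<le> b"
  shows "transport_value \<A> d r p u \<le> b"
  unfolding transport_value_def using assms zero_plan by (intro cSUP_least) auto

lemma transport_value_nonneg:
  assumes "0 \<le> r" "\<And>A. A \<in> \<A> \<Longrightarrow> 0 \<le> u A"
  shows "0 \<le> transport_value \<A> d r p u"
  using plan_value_le_transport_value[of "\<lambda>_ _. 0" r p u, OF zero_plan] assms
  by (simp add: plan_value_def)

lemma transport_value_mono:
  assumes "0 \<le> r" "\<And>A. A \<in> \<A> \<Longrightarrow> 0 \<le> u A" "\<And>A. A \<in> \<A> \<Longrightarrow> u A \<le> v A"
  shows "transport_value \<A> d r p u \<le> transport_value \<A> d r p v"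
proof (rule transport_value_leI[OF assms(1)])
  fix \<gamma> assume \<gamma>: "\<gamma> \<in> transport_plans \<A> d r p"
  then have "plan_value \<A> u \<gamma> \<le> plan_value \<A> v \<gamma>"
    using assms(3) unfolding plan_value_def transport_plans_def
    by (intro sum_mono mult_left_mono) auto
  also have "\<dots> \<le> transport_value \<A> d r p v"
    using assms by (intro plan_value_le_transport_value[OF \<gamma>]) (meson order_trans)
  finally show "plan_value \<A> u \<gamma> \<le> transport_value \<A> d r p v" .
qed

lemma transport_value_le_dual:
  assumes "0 \<le> r" "\<And>A. A \<in> \<A> \<Longrightarrow> 0 \<le> u A" "0 \<le> y"
  shows "transport_value \<A> d r p u \<le> r * y + (\<Sum>A\<in>\<A>. pmf p A * penalized \<A> d y u A)"
  using assms by (intro transport_value_leI plan_value_le_dual)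

lemma transport_value_mono_budget:
  assumes "0 \<le> a" "a \<le> b" "\<And>A. A \<in> \<A> \<Longrightarrow> 0 \<le> u A"
  shows "transport_value \<A> d a p u \<le> transport_value \<A> d b p u"
  using assms
  by (intro transport_value_leI plan_value_le_transport_value) (auto simp: transport_plans_def)

section \<open>Concavity in the budget and strong duality\<close>

lemma transport_plans_convex:
  assumes \<gamma>: "\<gamma> \<in> transport_plans \<A> d a p" "\<gamma>' \<in> transport_plans \<A> d b p"
    and t: "0 \<le> s" "0 \<le> t" "s + t = 1"
  shows "(\<lambda>A A'. s * \<gamma> A A' + t * \<gamma>' A A') \<in> transport_plans \<A> d (s * a + t * b) p"
  unfolding transport_plans_def
proof (intro CollectI conjI ballI)
  fix A assume A: "A \<in> \<A>"
  have "(\<Sum>A'\<in>\<A>. s * \<gamma> A A' + t * \<gamma>' A A') = s * (\<Sum>A'\<in>\<A>. \<gamma> A A') + t * (\<Sum>A'\<in>\<A>. \<gamma>' A A')"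
    by (simp add: sum.distrib sum_distrib_left)
  also have "\<dots> \<le> s * pmf p A + t * pmf p A"
    using \<gamma> t A by (intro add_mono mult_left_mono) (auto simp: transport_plans_def)
  also have "\<dots> = pmf p A" using t by (metis distrib_right mult_1)
  finally show "(\<Sum>A'\<in>\<A>. s * \<gamma> A A' + t * \<gamma>' A A') \<le> pmf p A" .
next
  have "(\<Sum>A\<in>\<A>. \<Sum>A'\<in>\<A>. d A A' * (s * \<gamma> A A' + t * \<gamma>' A A'))
      = s * (\<Sum>A\<in>\<A>. \<Sum>A'\<in>\<A>. d A A' * \<gamma> A A') + t * (\<Sum>A\<in>\<A>. \<Sum>A'\<in>\<A>. d A A' * \<gamma>' A A')"
    by (simp add: sum.distrib sum_distrib_left algebra_simps)
  also have "\<dots> \<le> s * a + t * b"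
    using \<gamma> t by (intro add_mono mult_left_mono) (auto simp: transport_plans_def)
  finally show "(\<Sum>A\<in>\<A>. \<Sum>A'\<in>\<A>. d A A' * (s * \<gamma> A A' + t * \<gamma>' A A')) \<le> s * a + t * b" .
qed (use \<gamma> t in \<open>auto simp: transport_plans_def\<close>)

text \<open>A mixture of plans for budgets \<open>a\<close> and \<open>b\<close> is a plan for the
  mixed budget, and the objective is linear in the plan. The two suprema are eliminated one after
  the other. The sign is reversed to fit the subgradient inequality for convex functions.\<close>

lemma transport_value_concave_budget:
  assumes u: "\<And>A. A \<in> \<A> \<Longrightarrow> 0 \<le> u A"
  shows "convex_on {0..} (\<lambda>b. - transport_value \<A> d b p u)"
proof (rule convex_onI)
  fix t a b :: real assume t: "0 < t" "t < 1" and ab: "a \<in> {0..}" "b \<in> {0..}"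
  let ?v = "\<lambda>b. transport_value \<A> d b p u"
  let ?X = "?v ((1 - t) * a + t * b)"
  have *: "(1 - t) * plan_value \<A> u \<gamma> + t * plan_value \<A> u \<gamma>' \<le> ?X"
    if "\<gamma> \<in> transport_plans \<A> d a p" "\<gamma>' \<in> transport_plans \<A> d b p" for \<gamma> \<gamma>'
  proof -
    have "(1 - t) * plan_value \<A> u \<gamma> + t * plan_value \<A> u \<gamma>'
        = plan_value \<A> u (\<lambda>A A'. (1 - t) * \<gamma> A A' + t * \<gamma>' A A')"
      unfolding plan_value_def
      by (simp add: distrib_right sum.distrib sum_distrib_left mult.assoc)
    also have "\<dots> \<le> ?X"
      using t by (intro plan_value_le_transport_value u transport_plans_convex that) auto
    finally show ?thesis .
  qed
  have "(1 - t) * ?v a + t * plan_value \<A> u \<gamma>' \<le> ?X" if \<gamma>': "\<gamma>' \<in> transport_plans \<A> d b p" for \<gamma>'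
  proof -
    have "?v a \<le> (?X - t * plan_value \<A> u \<gamma>') / (1 - t)"
      using *[OF _ \<gamma>'] t ab by (intro transport_value_leI) (auto simp: field_simps)
    then show ?thesis using t by (simp add: field_simps)
  qed
  then have "?v b \<le> (?X - (1 - t) * ?v a) / t"
    using t ab by (intro transport_value_leI) (auto simp: field_simps)
  then have "(1 - t) * ?v a + t * ?v b \<le> ?X"
    using t by (simp add: field_simps)
  then show "- ?v ((1 - t) *\<^sub>R a + t *\<^sub>R b) \<le> (1 - t) * - ?v a + t * - ?v b"
    by simp
qed auto

text \<open>The dual multiplier is a supergradient of the optimal value as a function of the budget.\<close>

lemma strong_duality:
  assumes r: "0 < r" and u: "\<And>A. A \<in> \<A> \<Longrightarrow> 0 \<le> u A"
  obtains y where "0 \<le> y"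
    "r * y + (\<Sum>A\<in>\<A>. pmf p A * penalized \<A> d y u A) \<le> transport_value \<A> d r p u"
proof -
  define v where "v b = transport_value \<A> d b p u" for b
  \<comment> \<open>Since \<open>r > 0\<close> is an interior point of the half-line, a finite slope
    exists. The witness is the right derivative of \<open>v\<close> at \<open>r\<close>, written as
    a negated infimum of difference quotients of \<open>- v\<close>.\<close>
  obtain s where s: "v b \<le> v r + s * (b - r)" if "0 \<le> b" for b
  proof -
    have "r \<in> interior {0::real..}" using r by simp
    from convex_le_Inf_differential[OF transport_value_concave_budget[OF u] this, where p1 = p]
    show ?thesis
      by (intro that[of "- Inf ((\<lambda>t. (- v r - - v t) / (r - t)) ` ({r<..} \<inter> {0..}))"])
         (force simp: v_def)
  qed
  have "v r \<le> v (r + 1)"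
    unfolding v_def using r u by (intro transport_value_mono_budget) auto
  with s[of "r + 1"] r have s0: "0 \<le> s" by simp
  have "\<forall>A. \<exists>A'. A' \<in> \<A> \<and> penalized \<A> d s u A = u A' - s * d A A'"
    by (metis penalized_attained)
  then obtain b where b: "\<And>A. b A \<in> \<A>" "\<And>A. penalized \<A> d s u A = u (b A) - s * d A (b A)"
    by metis
  \<comment> \<open>All mass of \<open>A\<close> goes to a maximizer \<open>b A\<close> of the
    penalized cost. This plan spends some budget \<open>B\<close>, in general different from
    \<open>r\<close>; the supergradient inequality at \<open>B\<close> turns its value into the dual
    value at \<open>r\<close>.\<close>
  define \<gamma> where "\<gamma> A A' = (if A' = b A then pmf p A else 0)" for A A'
  define B where "B = (\<Sum>A\<in>\<A>. d A (b A) * pmf p A)"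
  have delta: "(\<Sum>A'\<in>\<A>. \<gamma> A A' * f A') = pmf p A * f (b A)" for A f
    using finite_A b(1) by (simp add: \<gamma>_def if_distrib[of "\<lambda>z. z * _"] cong: if_cong)
  have "\<gamma> \<in> transport_plans \<A> d B p"
    unfolding transport_plans_def B_def using delta[of _ "\<lambda>_. 1"] delta[of _ "d _"]
    by (auto simp: \<gamma>_def mult.commute)
  then have "plan_value \<A> u \<gamma> \<le> v B"
    unfolding v_def by (intro plan_value_le_transport_value u)
  moreover have "plan_value \<A> u \<gamma> = (\<Sum>A\<in>\<A>. pmf p A * u (b A))"
    unfolding plan_value_def by (simp add: delta)
  moreover have "0 \<le> B"
    unfolding B_def using b d_nonneg by (intro sum_nonneg) auto
  moreover have "(\<Sum>A\<in>\<A>. pmf p A * penalized \<A> d s u A) = (\<Sum>A\<in>\<A>. pmf p A * u (b A)) - s * B"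
    unfolding B_def by (simp add: b sum_subtractf sum_distrib_left algebra_simps)
  ultimately have "r * s + (\<Sum>A\<in>\<A>. pmf p A * penalized \<A> d s u A) \<le> v r"
    using s[of B] by (simp add: algebra_simps)
  then show ?thesis using that s0 unfolding v_def by blast
qed

text \<open>Averaging plans for the components of a mixture gives a plan for the mixture.\<close>

lemma expectation_transport_value_le:
  assumes r: "0 < r" and u: "\<And>A. A \<in> \<A> \<Longrightarrow> 0 \<le> u A" and fin: "finite (set_pmf W)"
  shows "measure_pmf.expectation W (\<lambda>w. transport_value \<A> d r (f w) u)
    \<le> transport_value \<A> d r (bind_pmf W f) u"
proof (rule field_le_epsilon)
  fix e :: real assume e: "0 < e"
  have int: "integrable (measure_pmf W) h" for h :: "_ \<Rightarrow> real"
    using fin by (rule integrable_measure_pmf_finite)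
  \<comment> \<open>Plans within \<open>e\<close> of the supremum suffice, so attainment is not an
    issue.\<close>
  have "\<exists>\<gamma>\<in>transport_plans \<A> d r (f w). transport_value \<A> d r (f w) u - e < plan_value \<A> u \<gamma>" for w
  proof (rule ccontr)
    assume "\<not> ?thesis"
    then have "transport_value \<A> d r (f w) u \<le> transport_value \<A> d r (f w) u - e"
      using r by (intro transport_value_leI) (auto simp: not_less)
    with e show False by simp
  qed
  then obtain \<gamma> where \<gamma>: "\<And>w. \<gamma> w \<in> transport_plans \<A> d r (f w)"
    "\<And>w. transport_value \<A> d r (f w) u \<le> plan_value \<A> u (\<gamma> w) + e"
    by (metis less_diff_eq less_eq_real_def diff_less_eq)
  define G where "G A A' = measure_pmf.expectation W (\<lambda>w. \<gamma> w A A')" for A A'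
  have "G \<in> transport_plans \<A> d r (bind_pmf W f)"
    unfolding transport_plans_def
  proof (intro CollectI conjI ballI)
    fix A A' assume "A \<in> \<A>" "A' \<in> \<A>"
    then show "0 \<le> G A A'"
      unfolding G_def using \<gamma>(1) by (intro Bochner_Integration.integral_nonneg) (auto simp: transport_plans_def)
  next
    fix A assume A: "A \<in> \<A>"
    have "(\<Sum>A'\<in>\<A>. G A A') = measure_pmf.expectation W (\<lambda>w. \<Sum>A'\<in>\<A>. \<gamma> w A A')"
      unfolding G_def by (simp add: int)
    also have "\<dots> \<le> measure_pmf.expectation W (\<lambda>w. pmf (f w) A)"
      using \<gamma>(1) A by (intro integral_mono int) (auto simp: transport_plans_def)
    finally show "(\<Sum>A'\<in>\<A>. G A A') \<le> pmf (bind_pmf W f) A"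
      by (simp add: pmf_bind)
  next
    have "(\<Sum>A\<in>\<A>. \<Sum>A'\<in>\<A>. d A A' * G A A')
        = measure_pmf.expectation W (\<lambda>w. \<Sum>A\<in>\<A>. \<Sum>A'\<in>\<A>. d A A' * \<gamma> w A A')"
      unfolding G_def by (simp add: int)
    also have "\<dots> \<le> measure_pmf.expectation W (\<lambda>w. r)"
      using \<gamma>(1) by (intro integral_mono int) (auto simp: transport_plans_def)
    finally show "(\<Sum>A\<in>\<A>. \<Sum>A'\<in>\<A>. d A A' * G A A') \<le> r" by simp
  qed
  have "measure_pmf.expectation W (\<lambda>w. transport_value \<A> d r (f w) u)
      \<le> measure_pmf.expectation W (\<lambda>w. plan_value \<A> u (\<gamma> w) + e)"
    using \<gamma>(2) by (intro integral_mono int)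
  also have "\<dots> = plan_value \<A> u G + e"
    unfolding plan_value_def G_def by (simp add: int)
  also have "\<dots> \<le> transport_value \<A> d r (bind_pmf W f) u + e"
    using \<open>G \<in> _\<close> u by (intro add_right_mono plan_value_le_transport_value)
  finally show "measure_pmf.expectation W (\<lambda>w. transport_value \<A> d r (f w) u)
      \<le> transport_value \<A> d r (bind_pmf W f) u + e" .
qed

end

section \<open>Batches of independent samples\<close>

text \<open>Cutting both sets down to the supports makes them countable without changing
  probabilities, so the product rule for countable sets applies.\<close>

lemma measure_pair_pmf_Times:
  "measure_pmf.prob (pair_pmf M N) (A \<times> B) = measure_pmf.prob M A * measure_pmf.prob N B"
proof -
  have "measure_pmf.prob (pair_pmf M N) (A \<times> B)
      = measure_pmf.prob (pair_pmf M N) ((A \<inter> set_pmf M) \<times> (B \<inter> set_pmf N))"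
    by (subst measure_Int_set_pmf[symmetric]) (simp add: Times_Int_Times)
  also have "\<dots> = measure_pmf.prob M (A \<inter> set_pmf M) * measure_pmf.prob N (B \<inter> set_pmf N)"
    by (intro measure_pmf_prob_product countable_Int2 countable_set_pmf)
  finally show ?thesis by (simp add: measure_Int_set_pmf)
qed

text \<open>The event \<open>Q i\<close> reads only the samples of batch \<open>i\<close>, which is
  what \<open>local\<close> says. The joint law therefore splits off one batch at a time as an
  independent factor.\<close>

lemma prob_all_batches_le:
  assumes "finite I" "finite J"
    and "\<And>i. i \<in> I \<Longrightarrow> measure_pmf.prob (Pi_pmf ({i} \<times> J) df (\<lambda>_. p)) {\<omega>. Q i \<omega>} \<le> a"
    and local: "\<And>i \<omega> \<omega>'. (\<And>l. l \<in> J \<Longrightarrow> \<omega> (i, l) = \<omega>' (i, l)) \<Longrightarrow> Q i \<omega> = Q i \<omega>'"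
    and "0 \<le> a"
  shows "measure_pmf.prob (Pi_pmf (I \<times> J) df (\<lambda>_. p)) {\<omega>. \<forall>i\<in>I. Q i \<omega>} \<le> a ^ card I"
  using assms(1,3)
proof (induction I rule: finite_induct)
  case empty
  then show ?case by simp
next
  case (insert i I)
  let ?h = "\<lambda>(f, g) x. if x \<in> {i} \<times> J then f x else g x"
  have split: "insert i I \<times> J = {i} \<times> J \<union> I \<times> J" by auto
  have union: "Pi_pmf (insert i I \<times> J) df (\<lambda>_. p) = map_pmf ?h
      (pair_pmf (Pi_pmf ({i} \<times> J) df (\<lambda>_. p)) (Pi_pmf (I \<times> J) df (\<lambda>_. p)))"
    unfolding split using insert.hyps \<open>finite J\<close> by (intro Pi_pmf_union) auto
  have Qi: "Q i (?h (f, g)) = Q i f" for f g by (rule local) auto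
  have QI: "Q i' (?h (f, g)) = Q i' g" if "i' \<in> I" for i' f g
    using insert.hyps that by (intro local) auto
  have pre: "?h -` {\<omega>. \<forall>i'\<in>insert i I. Q i' \<omega>} = {\<omega>. Q i \<omega>} \<times> {\<omega>. \<forall>i'\<in>I. Q i' \<omega>}"
    using Qi QI by auto
  have "measure_pmf.prob (Pi_pmf (insert i I \<times> J) df (\<lambda>_. p)) {\<omega>. \<forall>i'\<in>insert i I. Q i' \<omega>}
      = measure_pmf.prob (Pi_pmf ({i} \<times> J) df (\<lambda>_. p)) {\<omega>. Q i \<omega>}
        * measure_pmf.prob (Pi_pmf (I \<times> J) df (\<lambda>_. p)) {\<omega>. \<forall>i'\<in>I. Q i' \<omega>}"
    unfolding union measure_map_pmf pre
    by (rule measure_pair_pmf_Times)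
  also have "\<dots> \<le> a * a ^ card I"
    using insert \<open>0 \<le> a\<close> by (intro mult_mono) auto
  finally show ?case using insert.hyps by simp
qed

text \<open>A uniformly chosen sample of a random batch has law \<open>p\<close>: after exchanging
  the two draws, each coordinate has marginal \<open>p\<close>. So the empirical distributions
  average to \<open>p\<close>.\<close>

lemma bind_empirical:
  assumes "finite I" "{i} \<times> {1..N} \<subseteq> I" "1 \<le> N"
  shows "bind_pmf (Pi_pmf I df (\<lambda>_. p)) (\<lambda>\<omega>. empirical N \<omega> i) = p"
proof -
  have "bind_pmf (Pi_pmf I df (\<lambda>_. p)) (\<lambda>\<omega>. empirical N \<omega> i)
      = bind_pmf (pmf_of_set {1..N}) (\<lambda>l. map_pmf (\<lambda>\<omega>. \<omega> (i, l)) (Pi_pmf I df (\<lambda>_. p)))"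
    unfolding empirical_def map_pmf_def by (rule bind_commute_pmf)
  also have "\<dots> = bind_pmf (pmf_of_set {1..N}) (\<lambda>l. p)"
    using assms by (intro bind_pmf_cong refl) (auto simp: Pi_pmf_component set_pmf_of_set subset_iff)
  finally show ?thesis by (simp add: bind_pmf_const)
qed

lemma set_pmf_empirical:
  assumes "1 \<le> N"
  shows "set_pmf (empirical N \<omega> i) = (\<lambda>l. \<omega> (i, l)) ` {1..N}"
  using assms unfolding empirical_def by (simp add: set_pmf_of_set)

lemma empirical_cong:
  assumes "1 \<le> N" "\<And>l. l \<in> {1..N} \<Longrightarrow> \<omega> (i, l) = \<omega>' (i, l)"
  shows "empirical N \<omega> i = empirical N \<omega>' i"
  unfolding empirical_def using assms by (intro map_pmf_cong) (auto simp: set_pmf_of_set)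

lemma sum_empirical:
  assumes "finite \<A>" "1 \<le> N" "\<And>l. l \<in> {1..N} \<Longrightarrow> \<omega> (i, l) \<in> \<A>"
  shows "(\<Sum>A\<in>\<A>. pmf (empirical N \<omega> i) A * F A) = (\<Sum>l\<in>{1..N}. F (\<omega> (i, l))) / real N"
proof -
  have "(\<Sum>A\<in>\<A>. pmf (empirical N \<omega> i) A * F A) = measure_pmf.expectation (empirical N \<omega> i) F"
    using assms by (subst integral_measure_pmf_real[of \<A>]) (auto simp: set_pmf_empirical mult.commute)
  also have "\<dots> = measure_pmf.expectation (pmf_of_set {1..N}) (\<lambda>l. F (\<omega> (i, l)))"
    unfolding empirical_def by simp
  also have "\<dots> = (\<Sum>l\<in>{1..N}. F (\<omega> (i, l))) / real N"
    using assms by (subst integral_pmf_of_set) auto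
  finally show ?thesis .
qed

lemma set_sample_batches:
  assumes "\<omega> \<in> set_pmf (sample_batches k N p)" "i \<in> {1..k}" "l \<in> {1..N}"
  shows "\<omega> (i, l) \<in> set_pmf p"
  using assms unfolding sample_batches_def by (auto simp: set_Pi_pmf PiE_dflt_def)

text \<open>Only underestimates by the sample are harmful later, so the one-sided Hoeffding bound is
  used. The sum deviates by \<open>N * t\<close>, and the squared ranges add up to
  \<open>N * M * M\<close>.\<close>

lemma hoeffding_empirical:
  assumes finA: "finite \<A>" and p: "set_pmf p \<subseteq> \<A>"
    and F: "\<And>A. A \<in> \<A> \<Longrightarrow> 0 \<le> F A \<and> F A \<le> M"
    and M: "0 < M" and t: "0 \<le> t" and N: "1 \<le> N" and i: "i \<in> {1..k}"
  shows "measure_pmf.prob (sample_batches k N p)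
      {\<omega>. (\<Sum>A\<in>\<A>. pmf (empirical N \<omega> i) A * F A) \<le> (\<Sum>A\<in>\<A>. pmf p A * F A) - t}
    \<le> exp (- 2 * real N * (t / M)\<^sup>2)"
proof -
  let ?W = "sample_batches k N p"
  define avg where "avg = (\<Sum>A\<in>\<A>. pmf p A * F A)"
  have mean: "measure_pmf.expectation ?W (\<lambda>\<omega>. F (\<omega> (i, l))) = avg" if "l \<in> {1..N}" for l
  proof -
    have "measure_pmf.expectation ?W (\<lambda>\<omega>. F (\<omega> (i, l)))
        = measure_pmf.expectation (map_pmf (\<lambda>\<omega>. \<omega> (i, l)) ?W) F"
      by simp
    also have "map_pmf (\<lambda>\<omega>. \<omega> (i, l)) ?W = p"
      unfolding sample_batches_def using that i by (subst Pi_pmf_component) auto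
    also have "measure_pmf.expectation p F = avg"
      unfolding avg_def using finA p by (subst integral_measure_pmf_real[of \<A>]) (auto simp: mult.commute)
    finally show ?thesis .
  qed
  interpret Hoeffding_ineq "measure_pmf ?W" "{i} \<times> {1..N}" "\<lambda>x \<omega>. F (\<omega> x)" "\<lambda>_. 0" "\<lambda>_. M"
    "\<Sum>x\<in>{i} \<times> {1..N}. measure_pmf.expectation ?W (\<lambda>\<omega>. F (\<omega> x))"
  proof unfold_locales
    have "prob_space.indep_vars (measure_pmf ?W) (\<lambda>_. count_space UNIV) (\<lambda>x \<omega>. \<omega> x) ({i} \<times> {1..N})"
      unfolding sample_batches_def
      by (rule prob_space.indep_vars_subset[OF measure_pmf.prob_space_axioms indep_vars_Pi_pmf]) (use i in auto)
    from prob_space.indep_vars_compose2[OF measure_pmf.prob_space_axioms this, of "\<lambda>_. F" "\<lambda>_. borel"]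
    show "prob_space.indep_vars (measure_pmf ?W) (\<lambda>_. borel) (\<lambda>x \<omega>. F (\<omega> x)) ({i} \<times> {1..N})"
      by simp
  next
    fix x assume x: "x \<in> {i} \<times> {1..N}"
    then have "\<omega> x \<in> \<A>" if "\<omega> \<in> set_pmf ?W" for \<omega>
      using set_sample_batches[OF that i, of "snd x"] p by auto
    then show "AE \<omega> in ?W. F (\<omega> x) \<in> {0..M}"
      using F by (auto simp: AE_measure_pmf_iff)
  qed auto
  have sums: "(\<Sum>x\<in>{i} \<times> {1..N}. h x) = (\<Sum>l\<in>{1..N}. h (i, l))" for h :: "_ \<Rightarrow> real"
    by (rule sum.reindex_bij_witness[of _ "\<lambda>l. (i, l)" snd]) auto
  \<comment> \<open>The events are compared on the support, where all samples lie in
    \<open>\<A>\<close> and the empirical mean is a sample average.\<close>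
  have "measure_pmf.prob ?W {\<omega>. (\<Sum>A\<in>\<A>. pmf (empirical N \<omega> i) A * F A) \<le> avg - t}
      = measure_pmf.prob ?W {\<omega>. (\<Sum>l\<in>{1..N}. F (\<omega> (i, l))) \<le> real N * avg - real N * t}"
  proof (rule measure_pmf.finite_measure_eq_AE)
    show "AE \<omega> in ?W. (\<omega> \<in> {\<omega>. (\<Sum>A\<in>\<A>. pmf (empirical N \<omega> i) A * F A) \<le> avg - t})
        = (\<omega> \<in> {\<omega>. (\<Sum>l\<in>{1..N}. F (\<omega> (i, l))) \<le> real N * avg - real N * t})"
      unfolding AE_measure_pmf_iff
    proof
      fix \<omega> assume "\<omega> \<in> set_pmf ?W"
      then have "\<omega> (i, l) \<in> \<A>" if "l \<in> {1..N}" for l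
        using set_sample_batches[OF _ i that] p by auto
      then have mean_eq: "(\<Sum>A\<in>\<A>. pmf (empirical N \<omega> i) A * F A) = (\<Sum>l\<in>{1..N}. F (\<omega> (i, l))) / real N"
        by (rule sum_empirical[OF finA N])
      have "s / real N \<le> avg - t \<longleftrightarrow> s \<le> real N * avg - real N * t" for s
        using N by (simp add: field_simps)
      from this[of "\<Sum>l\<in>{1..N}. F (\<omega> (i, l))", folded mean_eq]
      show "(\<omega> \<in> {\<omega>. (\<Sum>A\<in>\<A>. pmf (empirical N \<omega> i) A * F A) \<le> avg - t})
        = (\<omega> \<in> {\<omega>. (\<Sum>l\<in>{1..N}. F (\<omega> (i, l))) \<le> real N * avg - real N * t})"
        unfolding mem_Collect_eq .
    qed
  qed auto
  also have "\<dots> \<le> exp (- 2 * (real N * t)\<^sup>2 / (\<Sum>x\<in>{i} \<times> {1..N}. (M - 0)\<^sup>2))"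
    using Hoeffding_ineq_le[of "real N * t"] N M t by (simp add: sums[simplified] mean[simplified])
  also have "- 2 * (real N * t)\<^sup>2 / (\<Sum>x\<in>{i} \<times> {1..N}. (M - 0)\<^sup>2) = - 2 * real N * (t / M)\<^sup>2"
    using N M by (simp add: power2_eq_square field_simps)
  finally show ?thesis unfolding avg_def .
qed

section \<open>Nets in the polytope\<close>

lemma abs_index_le_norm2:
  assumes "x \<in> carrier_vec m" "i < m"
  shows "\<bar>x $ i\<bar> \<le> norm2 x"
proof -
  have "(x $ i)\<^sup>2 \<le> (\<Sum>j\<in>{0..<m}. (x $ j)\<^sup>2)"
    using assms by (intro member_le_sum) auto
  also have "\<dots> = x \<bullet> x"
    using assms by (simp add: scalar_prod_def power2_eq_square)
  finally show ?thesis
    unfolding norm2_def by (metis real_sqrt_abs real_sqrt_le_iff)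
qed

text \<open>One preimage is chosen for each value of \<open>f\<close> that occurs on
  \<open>P\<close>. The net thus consists of points of \<open>P\<close> itself, where subgradients
  are available.\<close>

lemma finite_representatives:
  assumes "finite S" "f ` P \<subseteq> S"
  obtains X where "X \<subseteq> P" "finite X" "card X \<le> card S" "\<And>x. x \<in> P \<Longrightarrow> \<exists>x'\<in>X. f x' = f x"
proof (rule that[of "inv_into P f ` f ` P"])
  have fin: "finite (f ` P)" using assms finite_subset by blast
  then show "finite (inv_into P f ` f ` P)" by simp
  show "inv_into P f ` f ` P \<subseteq> P" by (auto intro: inv_into_into)
  show "card (inv_into P f ` f ` P) \<le> card S"
    using card_image_le[OF fin, of "inv_into P f"] card_mono[OF assms] by simp
  show "\<exists>x'\<in>inv_into P f ` f ` P. f x' = f x" if "x \<in> P" for x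
    using that by (auto simp: f_inv_into_f)
qed

context dr_two_stage
begin

lemma P_carrier: "x \<in> P \<Longrightarrow> x \<in> carrier_vec m"
  using polytope unfolding polytope_in_def by auto

lemma zero_in_P: "0\<^sub>v m \<in> P"
  using P1_zero by (simp add: integer_points_def)

lemma cost_nonneg: "x \<in> P \<Longrightarrow> 0 \<le> c \<bullet> x"
  using P_nonneg[of x] P1_c P_carrier[of x] c_carrier
  by (auto simp: scalar_prod_def less_eq_vec_def intro!: sum_nonneg)

lemma R_nonneg: "0 \<le> R"
  using P3_outer[OF zero_in_P] by (simp add: norm2_def)

text \<open>Coordinates of points of \<open>P\<close> lie in \<open>[0, R]\<close>, so rounding them
  down to multiples of \<open>\<eta>\<close> leaves finitely many cells. Points of one cell differ
  by at most \<open>\<eta>\<close> in each coordinate.\<close>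

lemma finite_net:
  assumes \<eta>: "0 < \<eta>"
  obtains X where "X \<subseteq> P" "finite X" "card X \<le> (nat \<lfloor>R / \<eta>\<rfloor> + 1) ^ m"
    "\<And>x. x \<in> P \<Longrightarrow> \<exists>x'\<in>X. \<forall>i<m. \<bar>x $ i - x' $ i\<bar> \<le> \<eta>"
proof -
  let ?f = "\<lambda>x. \<lambda>i\<in>{..<m}. nat \<lfloor>x $ i / \<eta>\<rfloor>"
  let ?S = "{..<m} \<rightarrow>\<^sub>E {..nat \<lfloor>R / \<eta>\<rfloor>}"
  have "?f ` P \<subseteq> ?S"
  proof (intro image_subsetI PiE_I)
    fix x i assume x: "x \<in> P" and i: "i \<in> {..<m}"
    then have "x $ i \<le> R"
      using abs_index_le_norm2[OF P_carrier[OF x], of i] P3_outer[OF x] by simp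
    then have "x $ i / \<eta> \<le> R / \<eta>" using \<eta> by (simp add: divide_right_mono)
    then have "nat \<lfloor>x $ i / \<eta>\<rfloor> \<le> nat \<lfloor>R / \<eta>\<rfloor>" by (intro nat_mono floor_mono)
    with i show "?f x i \<in> {..nat \<lfloor>R / \<eta>\<rfloor>}" by simp
  qed simp
  moreover have "finite ?S" by (intro finite_PiE) auto
  ultimately obtain X where X: "X \<subseteq> P" "finite X" "card X \<le> card ?S"
    "\<And>x. x \<in> P \<Longrightarrow> \<exists>x'\<in>X. ?f x' = ?f x"
    using finite_representatives[of ?S ?f P] by blast
  have "\<exists>x'\<in>X. \<forall>i<m. \<bar>x $ i - x' $ i\<bar> \<le> \<eta>" if x: "x \<in> P" for x
  proof -
    obtain x' where x': "x' \<in> X" "?f x' = ?f x" using X(4)[OF x] by blast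
    then have x'P: "x' \<in> P" using X(1) by auto
    have "\<bar>x $ i - x' $ i\<bar> \<le> \<eta>" if i: "i < m" for i
    proof -
      have "0 \<le> x $ i" "0 \<le> x' $ i"
        using P_nonneg[OF x] P_nonneg[OF x'P] P_carrier[OF x] P_carrier[OF x'P] i
        by (auto simp: less_eq_vec_def)
      moreover have "nat \<lfloor>x' $ i / \<eta>\<rfloor> = nat \<lfloor>x $ i / \<eta>\<rfloor>"
        using fun_cong[OF x'(2), of i] i by simp
      \<comment> \<open>Nonnegativity of the coordinates matters here: \<open>nat\<close> would
        merge all negative floors.\<close>
      ultimately have "\<lfloor>x' $ i / \<eta>\<rfloor> = \<lfloor>x $ i / \<eta>\<rfloor>"
        using \<eta> by (simp add: nat_eq_iff)
      then have "\<bar>x $ i / \<eta> - x' $ i / \<eta>\<bar> \<le> 1" by linarith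
      then have "\<bar>x $ i - x' $ i\<bar> / \<eta> \<le> 1"
        using \<eta> by (simp add: abs_divide diff_divide_distrib[symmetric])
      then show ?thesis using \<eta> by simp
    qed
    then show ?thesis using x'(1) by blast
  qed
  moreover have "card ?S = (nat \<lfloor>R / \<eta>\<rfloor> + 1) ^ m" by (simp add: card_PiE)
  ultimately show ?thesis using that X by metis
qed

text \<open>The subgradient at \<open>x'\<close> gives
  \<open>g x' A \<le> g x A - d \<bullet> (x - x')\<close>. Each of the \<open>m\<close> coordinates
  contributes at most \<open>K * \<eta>\<close>, as the entries of \<open>d\<close> are bounded by
  its norm.\<close>

lemma g_lipschitz:
  assumes x: "x \<in> P" and x': "x' \<in> P" and A: "A \<in> \<A>" and near: "\<forall>i<m. \<bar>x $ i - x' $ i\<bar> \<le> \<eta>"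
  shows "g x' A \<le> g x A + real m * (K * \<eta>)"
proof -
  obtain d where d: "d \<in> carrier_vec m" "g x' A + d \<bullet> (x - x') \<le> g x A" "norm2 d \<le> K"
    using P5[OF x' A] x unfolding subgradient_on_def by blast
  have "- (d \<bullet> (x - x')) = (\<Sum>i\<in>{0..<m}. - (d $ i * (x $ i - x' $ i)))"
    using P_carrier[OF x] P_carrier[OF x'] by (simp add: scalar_prod_def sum_negf)
  also have "\<dots> \<le> (\<Sum>i\<in>{0..<m}. K * \<eta>)"
  proof (rule sum_mono)
    fix i assume i: "i \<in> {0..<m}"
    have "- (d $ i * (x $ i - x' $ i)) \<le> \<bar>d $ i\<bar> * \<bar>x $ i - x' $ i\<bar>"
      by (metis abs_ge_minus_self abs_mult)
    also have "\<dots> \<le> K * \<eta>"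
      using abs_index_le_norm2[OF d(1), of i] d(3) near i P5_K by (intro mult_mono) auto
    finally show "- (d $ i * (x $ i - x' $ i)) \<le> K * \<eta>" .
  qed
  finally show ?thesis using d(2) by simp
qed

end

section \<open>Expensive and inexpensive scenarios\<close>

text \<open>With \<open>w\<close> the cost at the origin, the same scenarios are kept for all
  \<open>x\<close>, and (P1) bounds the kept costs by \<open>M\<close>.\<close>

definition truncated :: "('a \<Rightarrow> real) \<Rightarrow> real \<Rightarrow> ('a \<Rightarrow> real) \<Rightarrow> 'a \<Rightarrow> real" where
  "truncated w M u A = (if w A \<le> M then u A else 0)"

context dr_two_stage
begin

lemma transport: "\<A> \<noteq> {} \<Longrightarrow> transport \<A> \<kappa>sc"
  using finite_scenarios metric_nonneg metric_refl by unfold_locales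

lemma g_nonneg: "x \<in> P \<Longrightarrow> A \<in> \<A> \<Longrightarrow> 0 \<le> g x A"
  using P1_g by blast

lemma h_val_nonneg:
  assumes "\<A> \<noteq> {}" "x \<in> P"
  shows "0 \<le> h_val \<A> c g \<kappa>sc r p x"
proof -
  interpret transport \<A> \<kappa>sc by (rule transport) fact
  show ?thesis
    using transport_value_nonneg[of r "g x" p] g_nonneg[OF assms(2)] r_pos cost_nonneg[OF assms(2)]
    unfolding h_val_def z_val_eq_transport_value by simp
qed

lemma bdd_below_h_val: "\<A> \<noteq> {} \<Longrightarrow> bdd_below (h_val \<A> c g \<kappa>sc r p ` P)"
  using h_val_nonneg by (intro bdd_belowI2[where m = 0]) auto

lemma truncated_bounds:
  assumes "x \<in> P" "A \<in> \<A>" "0 \<le> M"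
  shows "0 \<le> truncated (g (0\<^sub>v m)) M (g x) A" "truncated (g (0\<^sub>v m)) M (g x) A \<le> M"
    "truncated (g (0\<^sub>v m)) M (g x) A \<le> g x A"
  using P1_g[OF assms(1,2)] assms(3) unfolding truncated_def by auto

text \<open>
  By (P2), replacing \<open>x\<close> by the near-optimal \<open>x0\<close> changes the cost of an expensive scenario by at
  most \<open>lam * (c \<bullet> x0)\<close>, while a feasible plan moves only mass of order \<open>\<epsilon> / lam\<close> to expensive scenarios.
\<close>

lemma z_val_le_truncated:
  assumes ne: "\<A> \<noteq> {}" and x: "x \<in> P" and x0: "x0 \<in> P"
    and O1: "h_val \<A> c g \<kappa>sc r p x0 \<le> O1" "0 < O1" and \<epsilon>: "0 < \<epsilon>" "\<epsilon> \<le> 1 / 3"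
  shows "z_val \<A> g \<kappa>sc r p x
    \<le> transport_value \<A> \<kappa>sc r p (truncated (g (0\<^sub>v m)) (lam * O1 / \<epsilon>) (g x)) + (1 + 3 / 2 * \<epsilon>) * O1"
proof -
  interpret transport \<A> \<kappa>sc by (rule transport) fact
  define M where "M = lam * O1 / \<epsilon>"
  define u where "u = truncated (g (0\<^sub>v m)) M (g x)"
  define H where "H = {A\<in>\<A>. M < g (0\<^sub>v m) A}"
  have H: "finite H" "H \<subseteq> \<A>" unfolding H_def using finite_A by auto
  have M0: "0 \<le> M" unfolding M_def using P2_lambda O1 \<epsilon> by simp
  have z0: "c \<bullet> x0 + transport_value \<A> \<kappa>sc r p (g x0) \<le> O1"
    using O1 by (simp add: h_val_def z_val_eq_transport_value)
  have cx0: "0 \<le> c \<bullet> x0" by (rule cost_nonneg[OF x0])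
  have tv0: "0 \<le> transport_value \<A> \<kappa>sc r p (g x0)"
    using r_pos g_nonneg[OF x0] by (intro transport_value_nonneg) auto
  have "plan_value \<A> (g x) \<gamma> \<le> transport_value \<A> \<kappa>sc r p u + (1 + 3 / 2 * \<epsilon>) * O1"
    if \<gamma>: "\<gamma> \<in> transport_plans \<A> \<kappa>sc r p" for \<gamma>
  proof -
    have nn: "0 \<le> \<gamma> A A'" if "A \<in> \<A>" "A' \<in> \<A>" for A A'
      using \<gamma> that by (auto simp: transport_plans_def)
    \<comment> \<open>\<open>G\<close> is the mass that the plan moves to expensive scenarios,
      \<open>S\<close> its total cost at the origin.\<close>
    define G where "G = (\<Sum>A\<in>\<A>. \<Sum>A'\<in>H. \<gamma> A A')"
    define S where "S = (\<Sum>A\<in>\<A>. \<Sum>A'\<in>H. \<gamma> A A' * g (0\<^sub>v m) A')"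
    have "S \<le> (\<Sum>A\<in>\<A>. \<Sum>A'\<in>H. \<gamma> A A' * g x0 A' + lam * (c \<bullet> x0) * \<gamma> A A')"
      unfolding S_def
    proof (intro sum_mono)
      fix A A' assume A: "A \<in> \<A>" "A' \<in> H"
      then have "\<gamma> A A' * g (0\<^sub>v m) A' \<le> \<gamma> A A' * (g x0 A' + lam * (c \<bullet> x0))"
        using H by (intro mult_left_mono P2[OF x0] nn) auto
      then show "\<gamma> A A' * g (0\<^sub>v m) A' \<le> \<gamma> A A' * g x0 A' + lam * (c \<bullet> x0) * \<gamma> A A'"
        by (simp add: algebra_simps)
    qed
    also have "\<dots> = (\<Sum>A\<in>\<A>. \<Sum>A'\<in>H. \<gamma> A A' * g x0 A') + lam * (c \<bullet> x0) * G"
      unfolding G_def by (simp add: sum.distrib sum_distrib_left)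
    also have "(\<Sum>A\<in>\<A>. \<Sum>A'\<in>H. \<gamma> A A' * g x0 A') \<le> plan_value \<A> (g x0) \<gamma>"
      unfolding plan_value_def using finite_A H nn g_nonneg[OF x0]
      by (intro sum_mono sum_mono2) auto
    also have "\<dots> \<le> transport_value \<A> \<kappa>sc r p (g x0)"
      using g_nonneg[OF x0] by (intro plan_value_le_transport_value[OF \<gamma>])
    finally have S: "S \<le> transport_value \<A> \<kappa>sc r p (g x0) + c \<bullet> x0 * (lam * G)"
      by (simp add: mult_ac)
    have G0: "0 \<le> G" unfolding G_def using H nn by (intro sum_nonneg) auto
    \<comment> \<open>\<open>S\<close> bounds \<open>M * G\<close> from above and is itself bounded
      in terms of \<open>G\<close>. This pair of estimates forces \<open>lam * G\<close> to be of
      order \<open>\<epsilon>\<close>.\<close>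
    have "M * G = (\<Sum>A\<in>\<A>. \<Sum>A'\<in>H. \<gamma> A A' * M)"
      unfolding G_def by (simp add: sum_distrib_left mult.commute)
    also have "\<dots> \<le> S"
      unfolding S_def using H nn by (intro sum_mono mult_left_mono) (auto simp: H_def)
    also have "S \<le> O1 + O1 * (lam * G)"
    proof -
      have "c \<bullet> x0 * (lam * G) \<le> O1 * (lam * G)"
        using z0 tv0 G0 P2_lambda by (intro mult_right_mono) auto
      then show ?thesis using S z0 cx0 by linarith
    qed
    finally have "O1 * (lam * G) / \<epsilon> \<le> O1 * (1 + lam * G)"
      unfolding M_def by (simp add: algebra_simps)
    then have "O1 * (lam * G / \<epsilon>) \<le> O1 * (1 + lam * G)" by simp
    then have "lam * G / \<epsilon> \<le> 1 + lam * G" using O1(2) by (simp only: mult_le_cancel_left_pos)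
    then have "lam * G \<le> \<epsilon> + \<epsilon> * (lam * G)" using \<epsilon> by (simp add: field_simps)
    \<comment> \<open>From \<open>(1 - \<epsilon>) * (lam * G) \<le> \<epsilon>\<close> the constant
      \<open>3 / 2\<close> arises as \<open>1 / (1 - 1 / 3)\<close>.\<close>
    moreover have "\<epsilon> * (lam * G) \<le> 1 / 3 * (lam * G)"
      using \<epsilon> P2_lambda G0 by (intro mult_right_mono) auto
    ultimately have "lam * G \<le> 3 / 2 * \<epsilon>" by simp
    then have "c \<bullet> x0 * (lam * G) \<le> c \<bullet> x0 * (3 / 2 * \<epsilon>)"
      using cx0 by (rule mult_left_mono)
    also have "\<dots> \<le> O1 * (3 / 2 * \<epsilon>)"
      using z0 tv0 \<epsilon> by (intro mult_right_mono) auto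
    finally have S': "S \<le> (1 + 3 / 2 * \<epsilon>) * O1"
      using S z0 cx0 by (simp add: algebra_simps)
    \<comment> \<open>Mass arriving at kept scenarios earns \<open>u\<close>; mass arriving at
      expensive ones is charged the cost at the origin, which is no smaller by (P1).\<close>
    have "plan_value \<A> (g x) \<gamma> \<le> (\<Sum>A\<in>\<A>. (\<Sum>A'\<in>\<A>. \<gamma> A A' * u A') + (\<Sum>A'\<in>H. \<gamma> A A' * g (0\<^sub>v m) A'))"
      unfolding plan_value_def
    proof (rule sum_mono)
      fix A assume A: "A \<in> \<A>"
      have "(\<Sum>A'\<in>\<A>. \<gamma> A A' * g x A')
          \<le> (\<Sum>A'\<in>\<A>. \<gamma> A A' * u A' + (if A' \<in> H then \<gamma> A A' * g (0\<^sub>v m) A' else 0))"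
        using P1_g[OF x] nn[OF A]
        by (intro sum_mono) (auto simp: u_def truncated_def H_def intro!: mult_left_mono)
      also have "\<dots> = (\<Sum>A'\<in>\<A>. \<gamma> A A' * u A') + (\<Sum>A'\<in>H. \<gamma> A A' * g (0\<^sub>v m) A')"
        using finite_A H by (simp add: sum.distrib sum.inter_restrict[symmetric] Int_absorb1)
      finally show "(\<Sum>A'\<in>\<A>. \<gamma> A A' * g x A')
          \<le> (\<Sum>A'\<in>\<A>. \<gamma> A A' * u A') + (\<Sum>A'\<in>H. \<gamma> A A' * g (0\<^sub>v m) A')" .
    qed
    also have "\<dots> = plan_value \<A> u \<gamma> + S"
      by (simp add: plan_value_def S_def sum.distrib)
    also have "plan_value \<A> u \<gamma> \<le> transport_value \<A> \<kappa>sc r p u"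
      using truncated_bounds(1)[OF x _ M0] unfolding u_def
      by (intro plan_value_le_transport_value[OF \<gamma>])
    finally show ?thesis using S' by simp
  qed
  then show ?thesis
    unfolding z_val_eq_transport_value u_def M_def using r_pos by (intro transport_value_leI) auto
qed

text \<open>
  Since penalized costs decrease in the multiplier \<open>y\<close>, it suffices to test multipliers for which
  \<open>r * y\<close> is a multiple of \<open>e\<close>.  Those with \<open>r * y > M\<close> are worse than \<open>y = 0\<close>.
\<close>

lemma transport_value_truncated_le:
  assumes ne: "\<A> \<noteq> {}" and p: "set_pmf p \<subseteq> \<A>" and p': "set_pmf p' \<subseteq> \<A>" and x: "x \<in> P"
    and e: "0 < e" and M: "0 \<le> M" "M \<le> real L * e"
    and x': "x' \<in> P" "\<forall>i<m. \<bar>x $ i - x' $ i\<bar> \<le> \<eta>" and \<eta>: "real m * (K * \<eta>) \<le> e"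
    and dev: "\<And>a. a \<le> L \<Longrightarrow>
      (\<Sum>A\<in>\<A>. pmf p A * penalized \<A> \<kappa>sc (real a * e / r) (truncated (g (0\<^sub>v m)) M (g x')) A)
      \<le> (\<Sum>A\<in>\<A>. pmf p' A * penalized \<A> \<kappa>sc (real a * e / r) (truncated (g (0\<^sub>v m)) M (g x')) A) + e"
  shows "transport_value \<A> \<kappa>sc r p (truncated (g (0\<^sub>v m)) M (g x))
    \<le> transport_value \<A> \<kappa>sc r p' (truncated (g (0\<^sub>v m)) M (g x)) + 4 * e"
proof -
  interpret transport \<A> \<kappa>sc by (rule transport) fact
  define u where "u = truncated (g (0\<^sub>v m)) M (g x)"
  define v where "v = truncated (g (0\<^sub>v m)) M (g x')"
  have u: "0 \<le> u A" "u A \<le> M" if "A \<in> \<A>" for A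
    unfolding u_def using truncated_bounds[OF x that M(1)] by auto
  \<comment> \<open>Both points truncate the same scenarios, so the Lipschitz estimate survives
    truncation.\<close>
  have uv: "u A \<le> v A + e" if "A \<in> \<A>" for A
    using g_lipschitz[OF x'(1) x that, of \<eta>] x'(2) \<eta> e
    by (auto simp: u_def v_def truncated_def abs_minus_commute)
  have vu: "v A \<le> u A + e" if "A \<in> \<A>" for A
    using g_lipschitz[OF x x'(1) that x'(2)] \<eta> e
    by (auto simp: u_def v_def truncated_def)
  have shift: "(\<Sum>A\<in>\<A>. pmf q A * f A) \<le> (\<Sum>A\<in>\<A>. pmf q A * h A) + e"
    if q: "set_pmf q \<subseteq> \<A>" and le: "\<And>A. A \<in> \<A> \<Longrightarrow> f A \<le> h A + e" for q f h
  proof -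
    have "(\<Sum>A\<in>\<A>. pmf q A * f A) \<le> (\<Sum>A\<in>\<A>. pmf q A * h A + pmf q A * e)"
      using le by (intro sum_mono) (simp add: distrib_left[symmetric] mult_left_mono)
    also have "\<dots> = (\<Sum>A\<in>\<A>. pmf q A * h A) + e"
      using sum_pmf_eq_1[OF finite_A q] by (simp add: sum.distrib sum_distrib_right[symmetric])
    finally show ?thesis .
  qed
  obtain y where y: "0 \<le> y"
    "r * y + (\<Sum>A\<in>\<A>. pmf p' A * penalized \<A> \<kappa>sc y u A) \<le> transport_value \<A> \<kappa>sc r p' u"
    using strong_duality[OF r_pos, of u p'] u(1) by blast
  show ?thesis
  proof (cases "r * y \<le> M")
    case True
    \<comment> \<open>\<open>y\<close> is rounded up so that \<open>r * y'\<close> is a multiple of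
      \<open>e\<close>. This adds at most \<open>e\<close> to \<open>r * y\<close> and can only
      lower penalized costs; \<open>M \<le> real L * e\<close> keeps the index within
      \<open>L\<close>.\<close>
    define a where "a = nat \<lceil>r * y / e\<rceil>"
    define y' where "y' = real a * e / r"
    have ry: "0 \<le> r * y" using y(1) r_pos by simp
    have "r * y / e \<le> real L" using True M(2) e by (simp add: field_simps)
    then have aL: "a \<le> L" unfolding a_def by (simp add: ceiling_le_iff)
    have "real a = of_int \<lceil>r * y / e\<rceil>"
      unfolding a_def using ry e by simp
    then have "r * y / e \<le> real a" "real a \<le> r * y / e + 1" by linarith+
    then have "r * y \<le> real a * e" "real a * e \<le> r * y + e"
      using e by (auto simp: field_simps)
    then have yy': "y \<le> y'" "r * y' \<le> r * y + e"
      unfolding y'_def using r_pos by (auto simp: field_simps)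
    \<comment> \<open>The error \<open>4 * e\<close> consists of one \<open>e\<close> for rounding
      the multiplier, two for passing to the net point and back, and one for
      \<open>dev\<close>.\<close>
    have "transport_value \<A> \<kappa>sc r p u \<le> r * y' + (\<Sum>A\<in>\<A>. pmf p A * penalized \<A> \<kappa>sc y' u A)"
      using r_pos u y(1) yy' by (intro transport_value_le_dual) auto
    also have "(\<Sum>A\<in>\<A>. pmf p A * penalized \<A> \<kappa>sc y' u A) \<le> (\<Sum>A\<in>\<A>. pmf p A * penalized \<A> \<kappa>sc y' v A) + e"
      using uv by (intro shift p penalized_perturb)
    also have "(\<Sum>A\<in>\<A>. pmf p A * penalized \<A> \<kappa>sc y' v A) \<le> (\<Sum>A\<in>\<A>. pmf p' A * penalized \<A> \<kappa>sc y' v A) + e"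
      using dev[OF aL] unfolding y'_def v_def .
    also have "(\<Sum>A\<in>\<A>. pmf p' A * penalized \<A> \<kappa>sc y' v A) \<le> (\<Sum>A\<in>\<A>. pmf p' A * penalized \<A> \<kappa>sc y' u A) + e"
      using vu by (intro shift p' penalized_perturb)
    also have "(\<Sum>A\<in>\<A>. pmf p' A * penalized \<A> \<kappa>sc y' u A) \<le> (\<Sum>A\<in>\<A>. pmf p' A * penalized \<A> \<kappa>sc y u A)"
      using yy' by (intro sum_mono mult_left_mono penalized_antimono) auto
    finally show ?thesis
      using y(2) yy'(2) unfolding u_def by simp
  next
    case False
    have "transport_value \<A> \<kappa>sc r p u \<le> r * 0 + (\<Sum>A\<in>\<A>. pmf p A * penalized \<A> \<kappa>sc 0 u A)"
      using r_pos u by (intro transport_value_le_dual) auto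
    also have "\<dots> \<le> (\<Sum>A\<in>\<A>. pmf p A * M)"
      using u by (auto intro!: sum_mono mult_left_mono penalized_le_bound)
    also have "\<dots> = M"
      using sum_pmf_eq_1[OF finite_A p] by (simp add: sum_distrib_right[symmetric])
    also have "M \<le> r * y" using False by simp
    also have "\<dots> \<le> r * y + (\<Sum>A\<in>\<A>. pmf p' A * penalized \<A> \<kappa>sc y u A)"
      using u by (auto intro!: sum_nonneg mult_nonneg_nonneg penalized_nonneg)
    also note y(2)
    finally show ?thesis using e unfolding u_def by simp
  qed
qed

section \<open>Probabilities of the two bad events\<close>

lemma prob_all_batches_overestimate:
  assumes p: "set_pmf p \<subseteq> \<A>" and x0: "x0 \<in> P" and N: "1 \<le> N"
    and O1: "h_val \<A> c g \<kappa>sc r p x0 \<le> O1" "0 < O1" and \<epsilon>: "0 < \<epsilon>"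
  shows "measure_pmf.prob (sample_batches k N p)
      {\<omega>. \<forall>i\<in>{1..k}. (1 + \<epsilon>) * O1 \<le> h_val \<A> c g \<kappa>sc r (empirical N \<omega> i) x0} \<le> (1 / (1 + \<epsilon>)) ^ k"
proof -
  have ne: "\<A> \<noteq> {}" using p set_pmf_not_empty[of p] by auto
  interpret transport \<A> \<kappa>sc by (rule transport) fact
  have "measure_pmf.prob (sample_batches k N p)
      {\<omega>. \<forall>i\<in>{1..k}. (1 + \<epsilon>) * O1 \<le> h_val \<A> c g \<kappa>sc r (empirical N \<omega> i) x0} \<le> (1 / (1 + \<epsilon>)) ^ card {1..k}"
    unfolding sample_batches_def
  proof (rule prob_all_batches_le)
    fix i assume i: "i \<in> {1..k}"
    let ?W = "Pi_pmf ({i} \<times> {1..N}) undefined (\<lambda>_. p)"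
    let ?h = "\<lambda>\<omega>. h_val \<A> c g \<kappa>sc r (empirical N \<omega> i) x0"
    have fin: "finite (set_pmf ?W)"
      using p finite_A finite_subset by (subst set_Pi_pmf) (auto intro!: finite_PiE_dflt)
    then have int: "integrable (measure_pmf ?W) f" for f :: "_ \<Rightarrow> real"
      by (rule integrable_measure_pmf_finite)
    have "measure_pmf.expectation ?W ?h
        = c \<bullet> x0 + measure_pmf.expectation ?W (\<lambda>\<omega>. transport_value \<A> \<kappa>sc r (empirical N \<omega> i) (g x0))"
      unfolding h_val_def z_val_eq_transport_value
      by (subst Bochner_Integration.integral_add[OF int int]) simp
    \<comment> \<open>Jensen's inequality for the value as a concave function of the distribution;
      the mean of the empirical distributions is computed next.\<close>
    also have "\<dots> \<le> c \<bullet> x0 + transport_value \<A> \<kappa>sc r (bind_pmf ?W (\<lambda>\<omega>. empirical N \<omega> i)) (g x0)"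
      using g_nonneg[OF x0] fin r_pos by (intro add_left_mono expectation_transport_value_le)
    also have "bind_pmf ?W (\<lambda>\<omega>. empirical N \<omega> i) = p"
      using N by (intro bind_empirical) auto
    also have "c \<bullet> x0 + transport_value \<A> \<kappa>sc r p (g x0) \<le> O1"
      using O1 by (simp add: h_val_def z_val_eq_transport_value)
    finally have E: "measure_pmf.expectation ?W ?h \<le> O1" .
    have "measure_pmf.prob ?W {\<omega> \<in> space (measure_pmf ?W). (1 + \<epsilon>) * O1 \<le> ?h \<omega>}
        \<le> measure_pmf.expectation ?W ?h / ((1 + \<epsilon>) * O1)"
      using O1 \<epsilon> h_val_nonneg[OF ne x0] by (intro integral_Markov_inequality_measure[where A = "{}"] int) auto
    also have "\<dots> \<le> O1 / ((1 + \<epsilon>) * O1)"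
      using E O1 \<epsilon> by (intro divide_right_mono) auto
    also have "\<dots> = 1 / (1 + \<epsilon>)" using O1 by simp
    finally show "measure_pmf.prob ?W {\<omega>. (1 + \<epsilon>) * O1 \<le> ?h \<omega>} \<le> 1 / (1 + \<epsilon>)" by simp
  next
    fix i and \<omega> \<omega>' :: "nat \<times> nat \<Rightarrow> 'a"
    assume "\<And>l. l \<in> {1..N} \<Longrightarrow> \<omega> (i, l) = \<omega>' (i, l)"
    then have "empirical N \<omega> i = empirical N \<omega>' i" by (rule empirical_cong[OF N])
    then show "((1 + \<epsilon>) * O1 \<le> h_val \<A> c g \<kappa>sc r (empirical N \<omega> i) x0)
        = ((1 + \<epsilon>) * O1 \<le> h_val \<A> c g \<kappa>sc r (empirical N \<omega>' i) x0)" by simp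
  qed (use \<epsilon> in auto)
  then show ?thesis by simp
qed

text \<open>The net and the grid of multipliers are fixed before sampling, so a union bound applies.
  Its factors count batches, net points and the multipliers with index \<open>0\<close> to
  \<open>L\<close>. Hoeffding's bound applies to each test because penalized truncated costs lie in
  \<open>[0, M]\<close>.\<close>

lemma prob_some_test_fails:
  assumes p: "set_pmf p \<subseteq> \<A>" and X: "X \<subseteq> P" "finite X" and N: "1 \<le> N"
    and e: "0 < e" and M: "0 < M"
  shows "measure_pmf.prob (sample_batches k N p)
      {\<omega>. \<exists>i\<in>{1..k}. \<exists>x\<in>X. \<exists>a\<le>L.
        (\<Sum>A\<in>\<A>. pmf (empirical N \<omega> i) A * penalized \<A> \<kappa>sc (real a * e / r) (truncated (g (0\<^sub>v m)) M (g x)) A)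
        \<le> (\<Sum>A\<in>\<A>. pmf p A * penalized \<A> \<kappa>sc (real a * e / r) (truncated (g (0\<^sub>v m)) M (g x)) A) - e}
    \<le> real k * real (card X) * real (L + 1) * exp (- 2 * real N * (e / M)\<^sup>2)"
proof -
  have ne: "\<A> \<noteq> {}" using p set_pmf_not_empty[of p] by auto
  interpret transport \<A> \<kappa>sc by (rule transport) fact
  let ?F = "\<lambda>x a. penalized \<A> \<kappa>sc (real a * e / r) (truncated (g (0\<^sub>v m)) M (g x))"
  let ?B = "\<lambda>(i, x, a). {\<omega>. (\<Sum>A\<in>\<A>. pmf (empirical N \<omega> i) A * ?F x a A) \<le> (\<Sum>A\<in>\<A>. pmf p A * ?F x a A) - e}"
  let ?I = "{1..k} \<times> X \<times> {..L}"
  have "measure_pmf.prob (sample_batches k N p) (\<Union>(?B ` ?I))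
      \<le> (\<Sum>t\<in>?I. measure_pmf.prob (sample_batches k N p) (?B t))"
    using X by (intro measure_pmf.finite_measure_subadditive_finite) auto
  also have "\<dots> \<le> (\<Sum>t\<in>?I. exp (- 2 * real N * (e / M)\<^sup>2))"
  proof (rule sum_mono)
    fix t assume "t \<in> ?I"
    then obtain i x a where t: "t = (i, x, a)" "i \<in> {1..k}" "x \<in> X" by auto
    then have x: "x \<in> P" using X by auto
    have "measure_pmf.prob (sample_batches k N p)
        {\<omega>. (\<Sum>A\<in>\<A>. pmf (empirical N \<omega> i) A * ?F x a A) \<le> (\<Sum>A\<in>\<A>. pmf p A * ?F x a A) - e}
        \<le> exp (- 2 * real N * (e / M)\<^sup>2)"
      using finite_A p M e N t(2)
    proof (intro hoeffding_empirical conjI)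
      fix A assume A: "A \<in> \<A>"
      show "0 \<le> ?F x a A"
        using M truncated_bounds(1)[OF x A] by (intro penalized_nonneg A) auto
      show "?F x a A \<le> M"
        using M e r_pos truncated_bounds(2)[OF x] by (intro penalized_le_bound A) auto
    qed auto
    then show "measure_pmf.prob (sample_batches k N p) (?B t) \<le> exp (- 2 * real N * (e / M)\<^sup>2)"
      unfolding t by simp
  qed
  also have "\<dots> = real k * real (card X) * real (L + 1) * exp (- 2 * real N * (e / M)\<^sup>2)"
    by (simp add: card_cartesian_product algebra_simps)
  also have "\<Union>(?B ` ?I) = {\<omega>. \<exists>i\<in>{1..k}. \<exists>x\<in>X. \<exists>a\<le>L.
      (\<Sum>A\<in>\<A>. pmf (empirical N \<omega> i) A * ?F x a A) \<le> (\<Sum>A\<in>\<A>. pmf p A * ?F x a A) - e}"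
    by auto
  finally show ?thesis .
qed

end

section \<open>The approximation guarantee\<close>

text \<open>For \<open>\<epsilon> \<le> 1 / 3\<close> the bound \<open>\<epsilon> - \<epsilon> *
  \<epsilon> \<le> ln (1 + \<epsilon>)\<close> yields
  \<open>ln (1 + \<epsilon>) \<ge> \<epsilon> / 2\<close>, so \<open>k\<close> times this logarithm
  reaches \<open>ln (1 / \<delta>)\<close>.\<close>

lemma inverse_one_plus_power_le:
  fixes \<epsilon> \<delta> :: real
  assumes "0 < \<epsilon>" "\<epsilon> \<le> 1 / 3" "0 < \<delta>" "\<delta> < 1"
  shows "(1 / (1 + \<epsilon>)) ^ nat \<lceil>2 / \<epsilon> * ln (1 / \<delta>)\<rceil> \<le> \<delta>"
proof -
  define k where "k = nat \<lceil>2 / \<epsilon> * ln (1 / \<delta>)\<rceil>"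
  have l: "0 < ln (1 / \<delta>)" using assms by simp
  have "\<epsilon> * \<epsilon> \<le> \<epsilon> * (1 / 3)" using assms by (intro mult_left_mono) auto
  moreover have "\<epsilon> - \<epsilon> * \<epsilon> \<le> ln (1 + \<epsilon>)"
    using ln_one_plus_pos_lower_bound[of \<epsilon>] assms by (simp add: power2_eq_square)
  ultimately have "\<epsilon> / 2 \<le> ln (1 + \<epsilon>)" using assms(1) by linarith
  moreover have "2 / \<epsilon> * ln (1 / \<delta>) \<le> real k"
    unfolding k_def by linarith
  ultimately have "(2 / \<epsilon> * ln (1 / \<delta>)) * (\<epsilon> / 2) \<le> real k * ln (1 + \<epsilon>)"
    using assms by (intro mult_mono) auto
  then have "- (real k * ln (1 + \<epsilon>)) \<le> ln \<delta>"
    using assms by (simp add: ln_div)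
  then have "exp (- (real k * ln (1 + \<epsilon>))) \<le> \<delta>"
    using assms by (metis exp_le_cancel_iff exp_ln)
  moreover have "exp (- (real k * ln (1 + \<epsilon>))) = (1 / (1 + \<epsilon>)) ^ k"
    using assms by (simp add: exp_minus exp_of_nat_mult power_one_over inverse_eq_divide)
  ultimately show ?thesis unfolding k_def by simp
qed

context dr_two_stage
begin

text \<open>Only two events have to be avoided, each of probability at most \<open>\<delta>\<close>;
  \<open>size\<close> is the union bound with the sizes of net and grid inserted. Since
  \<open>xbar\<close>, \<open>fbar\<close> and \<open>j\<close> are quantified inside the event,
  they may depend on the samples in any way.\<close>

lemma success_probability:
  fixes pstar :: "'a pmf"
  assumes p: "set_pmf pstar \<subseteq> \<A>"
    and LB: "0 < LB" "LB \<le> (INF x\<in>P. h_val \<A> c g \<kappa>sc r pstar x)"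
    and \<epsilon>: "0 < \<epsilon>" "\<epsilon> \<le> 1 / 3" and \<delta>: "0 < \<delta>" "\<delta> < 1"
    and \<beta>: "1 \<le> \<beta>" and \<rho>: "1 \<le> \<rho>" and N: "1 \<le> N"
    and k: "k = nat \<lceil>2 / \<epsilon> * ln (1 / \<delta>)\<rceil>"
    and size: "real k * (R * (real m + 1) * K / (\<epsilon> * LB) + 1) ^ m * (lam / \<epsilon>\<^sup>2 + 2)
      * exp (- 2 * real N * (\<epsilon>\<^sup>2 / lam)\<^sup>2) \<le> \<delta>"
  shows "1 - 2 * \<delta> \<le> measure_pmf.prob (sample_batches k N pstar)
             {\<omega>. \<forall>xbar fbar j.
                (\<forall>i\<in>{1..k}. xbar i \<in> P \<and>
                   h_val \<A> c g \<kappa>sc r (empirical N \<omega> i) (xbar i) \<le> \<beta> * fbar i \<and>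
                   fbar i \<le> \<rho> * (INF x\<in>P. h_val \<A> c g \<kappa>sc r (empirical N \<omega> i) x)) \<longrightarrow>
                j \<in> {1..k} \<longrightarrow> (\<forall>i\<in>{1..k}. fbar j \<le> fbar i) \<longrightarrow>
                h_val \<A> c g \<kappa>sc r pstar (xbar j)
                  \<le> 4 * \<beta> * \<rho> * (1 + 2 * \<epsilon>) * (INF x\<in>P. h_val \<A> c g \<kappa>sc r pstar x)}"
    (is "_ \<le> measure_pmf.prob ?W ?good")
proof -
  have ne: "\<A> \<noteq> {}" using p set_pmf_not_empty[of pstar] by auto
  interpret transport \<A> \<kappa>sc by (rule transport) fact
  let ?h = "h_val \<A> c g \<kappa>sc r"
  define OPT where "OPT = (INF x\<in>P. ?h pstar x)"
  \<comment> \<open>The factor \<open>1 + \<epsilon>\<close> above the infimum guarantees a point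
    \<open>x0\<close> of cost below \<open>O1\<close>.\<close>
  define O1 where "O1 = (1 + \<epsilon>) * OPT"
  define e where "e = \<epsilon> * O1"
  define M where "M = lam * O1 / \<epsilon>"
  \<comment> \<open>The net width makes the Lipschitz error at most \<open>e\<close>;
    \<open>real m + 1\<close> in place of \<open>real m\<close> avoids a zero denominator.
    \<open>L\<close> steps of size \<open>e\<close> reach \<open>M\<close>, because
    \<open>M / e = lam / (\<epsilon> * \<epsilon>)\<close>.\<close>
  define \<eta> where "\<eta> = e / ((real m + 1) * K)"
  define L where "L = nat \<lceil>lam / \<epsilon>\<^sup>2\<rceil>"
  have OPT: "0 < OPT" "LB \<le> OPT" using LB by (auto simp: OPT_def)
  have O1: "OPT < O1" "0 < O1" unfolding O1_def using OPT \<epsilon> by simp_all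
  have e0: "0 < e" and M0: "0 < M" unfolding e_def M_def using O1 \<epsilon> P2_lambda by auto
  have \<eta>0: "0 < \<eta>" unfolding \<eta>_def using e0 P5_K by simp
  obtain x0 where x0: "x0 \<in> P" "?h pstar x0 < O1"
    using O1(1) zero_in_P cINF_less_iff[OF _ bdd_below_h_val[OF ne], of pstar O1]
    unfolding OPT_def by blast
  obtain X where X: "X \<subseteq> P" "finite X" "card X \<le> (nat \<lfloor>R / \<eta>\<rfloor> + 1) ^ m"
    "\<And>x. x \<in> P \<Longrightarrow> \<exists>x'\<in>X. \<forall>i<m. \<bar>x $ i - x' $ i\<bar> \<le> \<eta>"
    using finite_net[OF \<eta>0] by metis
  have M_le: "M \<le> real L * e"
  proof -
    have "M = (lam / \<epsilon>\<^sup>2) * e"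
      unfolding M_def e_def using \<epsilon> by (simp add: power2_eq_square field_simps)
    also have "\<dots> \<le> real L * e"
      unfolding L_def using e0 by (intro mult_right_mono) linarith+
    finally show ?thesis .
  qed
  have \<eta>e: "real m * (K * \<eta>) \<le> e"
  proof -
    have "real m * (K * \<eta>) = real m * e / (real m + 1)"
      unfolding \<eta>_def using P5_K by simp
    also have "\<dots> \<le> e"
      using e0 by (subst pos_divide_le_eq) (auto simp: algebra_simps)
    finally show ?thesis .
  qed
  define T where "T p x a = (\<Sum>A\<in>\<A>. pmf p A * penalized \<A> \<kappa>sc (real a * e / r)
      (truncated (g (0\<^sub>v m)) M (g x)) A)" for p x and a :: nat
  define B1 where "B1 = {\<omega>. \<forall>i\<in>{1..k}. (1 + \<epsilon>) * O1 \<le> ?h (empirical N \<omega> i) x0}"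
  define B2 where "B2 = {\<omega>. \<exists>i\<in>{1..k}. \<exists>x\<in>X. \<exists>a\<le>L. T (empirical N \<omega> i) x a \<le> T pstar x a - e}"
  have B1: "measure_pmf.prob ?W B1 \<le> \<delta>"
    using prob_all_batches_overestimate[OF p x0(1) N less_imp_le[OF x0(2)] O1(2) \<epsilon>(1), of k]
      inverse_one_plus_power_le[OF \<epsilon> \<delta>] unfolding B1_def k by linarith
  have B2: "measure_pmf.prob ?W B2 \<le> \<delta>"
  proof -
    \<comment> \<open>The width depends on the unknown optimum; in the estimate of the net size the
      known bound \<open>LB\<close> takes its place.\<close>
    have "R / \<eta> = R * (real m + 1) * K / (\<epsilon> * O1)"
      unfolding \<eta>_def e_def by simp
    also have "\<dots> \<le> R * (real m + 1) * K / (\<epsilon> * LB)"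
      using O1 OPT LB \<epsilon> R_nonneg P5_K by (intro divide_left_mono) auto
    finally have "of_int \<lfloor>R / \<eta>\<rfloor> \<le> R * (real m + 1) * K / (\<epsilon> * LB)"
      by (rule order_trans[OF of_int_floor_le])
    then have "real (nat \<lfloor>R / \<eta>\<rfloor> + 1) \<le> R * (real m + 1) * K / (\<epsilon> * LB) + 1"
      using R_nonneg \<eta>0 by simp
    then have "real (nat \<lfloor>R / \<eta>\<rfloor> + 1) ^ m \<le> (R * (real m + 1) * K / (\<epsilon> * LB) + 1) ^ m"
      by (intro power_mono) auto
    then have "real (card X) \<le> (R * (real m + 1) * K / (\<epsilon> * LB) + 1) ^ m"
      using X(3) by (metis of_nat_le_iff of_nat_power order_trans)
    moreover have "real (L + 1) \<le> lam / \<epsilon>\<^sup>2 + 2"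
      unfolding L_def using of_int_ceiling_le_add_one[of "lam / \<epsilon>\<^sup>2"] P2_lambda by (simp add: add.commute)
    ultimately have "real k * real (card X) * real (L + 1) * exp (- 2 * real N * (e / M)\<^sup>2)
        \<le> real k * (R * (real m + 1) * K / (\<epsilon> * LB) + 1) ^ m * (lam / \<epsilon>\<^sup>2 + 2)
          * exp (- 2 * real N * (e / M)\<^sup>2)"
      using R_nonneg P5_K \<epsilon> LB by (intro mult_right_mono mult_mono) auto
    also have "\<dots> \<le> \<delta>"
    proof -
      have "e / M = \<epsilon>\<^sup>2 / lam"
        unfolding e_def M_def using O1 \<epsilon> by (simp add: power2_eq_square)
      then show ?thesis using size by (simp only:)
    qed
    finally show ?thesis
      using prob_some_test_fails[OF p X(1,2) N e0 M0, of k L] unfolding B2_def T_def by linarith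
  qed
  \<comment> \<open>Restriction to the support puts every empirical distribution on
    \<open>\<A>\<close>.\<close>
  have sub: "set_pmf ?W - (B1 \<union> B2) \<subseteq> ?good"
  proof (intro subsetI CollectI allI impI)
    fix \<omega> xbar fbar j
    assume \<omega>: "\<omega> \<in> set_pmf ?W - (B1 \<union> B2)"
      and approx: "\<forall>i\<in>{1..k}. xbar i \<in> P \<and> ?h (empirical N \<omega> i) (xbar i) \<le> \<beta> * fbar i \<and>
                   fbar i \<le> \<rho> * (INF x\<in>P. ?h (empirical N \<omega> i) x)"
      and j: "j \<in> {1..k}" and min: "\<forall>i\<in>{1..k}. fbar j \<le> fbar i"
    let ?p = "empirical N \<omega>"
    define u where "u = truncated (g (0\<^sub>v m)) M (g (xbar j))"
    have emp: "set_pmf (?p i) \<subseteq> \<A>" if "i \<in> {1..k}" for i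
      using set_sample_batches[of \<omega> k N pstar i] that p N \<omega> by (auto simp: set_pmf_empirical)
    have xj: "xbar j \<in> P" using approx j by auto
    \<comment> \<open>Batch \<open>i\<close> does not overestimate \<open>x0\<close>. The selected
      \<open>j\<close> may be another batch, but \<open>fbar j\<close> is no larger than
      \<open>fbar i\<close>.\<close>
    obtain i where i: "i \<in> {1..k}" "?h (?p i) x0 < (1 + \<epsilon>) * O1"
      using \<omega> unfolding B1_def by force
    have "(INF x\<in>P. ?h (?p i) x) \<le> (1 + \<epsilon>) * O1"
      using cINF_lower[OF bdd_below_h_val[OF ne] x0(1), of "?p i"] i(2) by simp
    then have "\<rho> * (INF x\<in>P. ?h (?p i) x) \<le> \<rho> * ((1 + \<epsilon>) * O1)"
      using \<rho> by (intro mult_left_mono) auto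
    then have "fbar j \<le> \<rho> * ((1 + \<epsilon>) * O1)"
      using approx min i(1) by fastforce
    then have "\<beta> * fbar j \<le> \<beta> * (\<rho> * ((1 + \<epsilon>) * O1))"
      using \<beta> by (intro mult_left_mono) auto
    then have emp_j: "?h (?p j) (xbar j) \<le> \<beta> * \<rho> * ((1 + \<epsilon>) * O1)"
      using approx j by fastforce
    obtain x' where x': "x' \<in> X" "\<forall>i<m. \<bar>xbar j $ i - x' $ i\<bar> \<le> \<eta>"
      using X(4)[OF xj] by blast
    have tests: "T pstar x' a \<le> T (?p j) x' a + e" if "a \<le> L" for a
      using \<omega> j x'(1) that unfolding B2_def by force
    have "transport_value \<A> \<kappa>sc r pstar u \<le> transport_value \<A> \<kappa>sc r (?p j) u + 4 * e"
      unfolding u_def using X(1) x' M0 tests[unfolded T_def]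
      by (intro transport_value_truncated_le[OF ne p emp[OF j] xj e0 _ M_le _ _ \<eta>e]) auto
    also have "transport_value \<A> \<kappa>sc r (?p j) u \<le> transport_value \<A> \<kappa>sc r (?p j) (g (xbar j))"
      unfolding u_def using r_pos truncated_bounds[OF xj] M0 by (intro transport_value_mono) auto
    finally have low: "transport_value \<A> \<kappa>sc r pstar u
        \<le> z_val \<A> g \<kappa>sc r (?p j) (xbar j) + 4 * e"
      by (simp add: z_val_eq_transport_value)
    have "z_val \<A> g \<kappa>sc r pstar (xbar j)
        \<le> transport_value \<A> \<kappa>sc r pstar u + (1 + 3 / 2 * \<epsilon>) * O1"
      unfolding u_def M_def by (rule z_val_le_truncated[OF ne xj x0(1) less_imp_le[OF x0(2)] O1(2) \<epsilon>])
    \<comment> \<open>The coefficient \<open>11 / 2\<close> is \<open>3 / 2\<close> from the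
      expensive scenarios plus \<open>4\<close> from the tests.\<close>
    with low have "?h pstar (xbar j) \<le> ?h (?p j) (xbar j) + (1 + 11 / 2 * \<epsilon>) * O1"
      unfolding h_val_def e_def by (simp add: algebra_simps)
    also have "\<dots> \<le> \<beta> * \<rho> * ((1 + \<epsilon>) * O1) + \<beta> * \<rho> * ((1 + 11 / 2 * \<epsilon>) * O1)"
    proof (rule add_mono[OF emp_j])
      have "1 * 1 \<le> \<beta> * \<rho>" using \<beta> \<rho> by (intro mult_mono) auto
      then have "1 * ((1 + 11 / 2 * \<epsilon>) * O1) \<le> \<beta> * \<rho> * ((1 + 11 / 2 * \<epsilon>) * O1)"
        using O1 \<epsilon> by (intro mult_right_mono) auto
      then show "(1 + 11 / 2 * \<epsilon>) * O1 \<le> \<beta> * \<rho> * ((1 + 11 / 2 * \<epsilon>) * O1)" by simp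
    qed
    also have "\<dots> = \<beta> * \<rho> * ((2 + 13 / 2 * \<epsilon>) * (1 + \<epsilon>)) * OPT"
      unfolding O1_def by (simp add: algebra_simps)
    \<comment> \<open>The leading constant is \<open>2\<close>; the slack up to \<open>4\<close>
      absorbs the surplus in the terms with \<open>\<epsilon>\<close>.\<close>
    also have "\<dots> \<le> \<beta> * \<rho> * (4 * (1 + 2 * \<epsilon>)) * OPT"
    proof -
      have "\<epsilon> * \<epsilon> \<le> \<epsilon> * (1 / 3)" using \<epsilon> by (intro mult_left_mono) auto
      then have "2 + 17 / 2 * \<epsilon> + 13 / 2 * (\<epsilon> * \<epsilon>) \<le> 4 + 8 * \<epsilon>"
        using \<epsilon> by linarith
      moreover have "(2 + 13 / 2 * \<epsilon>) * (1 + \<epsilon>) = 2 + 17 / 2 * \<epsilon> + 13 / 2 * (\<epsilon> * \<epsilon>)"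
        by (simp add: field_simps)
      ultimately have "(2 + 13 / 2 * \<epsilon>) * (1 + \<epsilon>) \<le> 4 * (1 + 2 * \<epsilon>)"
        by simp
      then show ?thesis
        using \<beta> \<rho> OPT by (intro mult_right_mono mult_left_mono) auto
    qed
    finally show "?h pstar (xbar j) \<le> 4 * \<beta> * \<rho> * (1 + 2 * \<epsilon>) * (INF x\<in>P. ?h pstar x)"
      unfolding OPT_def by (simp add: mult_ac)
  qed
  have "1 - 2 * \<delta> \<le> 1 - measure_pmf.prob ?W (B1 \<union> B2)"
    using measure_Un_le[of B1 ?W B2] B1 B2 by simp
  also have "\<dots> = measure_pmf.prob ?W (- (B1 \<union> B2))"
    by (subst measure_pmf.prob_compl[of "B1 \<union> B2", simplified, symmetric]) (auto simp: Compl_eq_Diff_UNIV)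
  also have "\<dots> = measure_pmf.prob ?W (- (B1 \<union> B2) \<inter> set_pmf ?W)"
    by (simp add: measure_Int_set_pmf)
  also have "\<dots> \<le> measure_pmf.prob ?W ?good"
    using sub by (intro measure_pmf.finite_measure_mono) auto
  finally show ?thesis .
qed

text \<open>Every factor of the union bound is at most the exponential of a polynomial in
  \<open>T\<close>. With \<open>ln (1 / \<delta>)\<close> added, the total exponent is at most
  \<open>(5 + a) * T ^ (d + 2)\<close>, while each sample contributes at least
  \<open>1 / s ^ 4 \<ge> 1 / T ^ 4\<close> to the rate. This explains the power
  \<open>d + 6\<close>.\<close>

lemma sample_size_sufficient:
  fixes a :: real
  assumes a: "0 \<le> a" and poly: "poly q (real sz) \<le> a * (1 + real sz) ^ d"
    and LB: "0 < LB" and \<epsilon>: "0 < \<epsilon>" "\<epsilon> \<le> 1 / 3" and \<delta>: "0 < \<delta>" "\<delta> < 1"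
    and k: "k = nat \<lceil>2 / \<epsilon> * ln (1 / \<delta>)\<rceil>"
    and N: "(5 + a) * (1 + lam / \<epsilon> + max 0 (ln (\<tau> * R / (V * LB))) + ln (1 / \<delta>) + real sz) ^ (d + 6) \<le> real N"
  shows "real k * (R * (real m + 1) * K / (\<epsilon> * LB) + 1) ^ m * (lam / \<epsilon>\<^sup>2 + 2)
      * exp (- 2 * real N * (\<epsilon>\<^sup>2 / lam)\<^sup>2) \<le> \<delta>"
proof -
  define s where "s = lam / \<epsilon>"
  define t where "t = max 0 (ln (\<tau> * R / (V * LB)))"
  define u where "u = ln (1 / \<delta>)"
  define T where "T = 1 + s + t + u + real sz"
  define Q where "Q = a * T ^ d"
  define E where "E = t + real sz + Q + s"
  have u0: "0 < u" unfolding u_def using \<delta> by simp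
  have t0: "0 \<le> t" unfolding t_def by simp
  have s_ge: "1 / \<epsilon> \<le> s" unfolding s_def using P2_lambda \<epsilon> by (simp add: divide_right_mono)
  have "0 < 1 / \<epsilon>" using \<epsilon> by simp
  with s_ge have s0: "0 < s" by linarith
  have T: "1 \<le> T" "s \<le> T" "t + real sz + s + 1 \<le> T" "u \<le> T" "1 + real sz \<le> T" "1 + s \<le> T"
    unfolding T_def using u0 t0 s0 by auto
  have "poly q (real sz) \<le> a * T ^ d"
    using poly T(5) a by (smt (verit) mult_left_mono power_mono of_nat_0_le_iff)
  then have Q: "poly q (real sz) \<le> Q" "0 \<le> Q" unfolding Q_def using a T(1) by auto
  have E0: "0 \<le> E" unfolding E_def using t0 Q s0 by simp
  have k_le: "real k \<le> exp (2 * s * u)"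
  proof -
    have "2 / \<epsilon> * u = 2 * (1 / \<epsilon>) * u" by simp
    also have "\<dots> \<le> 2 * s * u" using s_ge u0 by (intro mult_right_mono mult_left_mono) auto
    finally have "2 / \<epsilon> * u \<le> 2 * s * u" .
    moreover have "0 \<le> 2 / \<epsilon> * u" using \<epsilon> u0 by simp
    ultimately have "real k \<le> 1 + 2 * s * u" unfolding k u_def[symmetric] by linarith
    also have "\<dots> \<le> exp (2 * s * u)" by (rule exp_ge_add_one_self)
    finally show ?thesis .
  qed
  have net_le: "(R * (real m + 1) * K / (\<epsilon> * LB) + 1) ^ m \<le> exp (real m * (E + 1))"
  proof -
    \<comment> \<open>The factor \<open>\<tau> / V\<close> is at least 1, as
      \<open>V \<le> 1 \<le> \<tau>\<close>. The case \<open>R = 0\<close> is separate because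
      \<open>exp\<close> undoes \<open>ln\<close> only at positive arguments.\<close>
    have RLB: "R / LB \<le> exp t"
    proof (cases "R = 0")
      case False
      then have R: "0 < R" using R_nonneg by simp
      have "R / LB * V \<le> R / LB * \<tau>"
        using R LB P3_V P6_tau by (intro mult_left_mono) auto
      then have "R / LB \<le> \<tau> * R / (V * LB)"
        using LB P3_V by (simp add: field_simps)
      also have "\<dots> = exp (ln (\<tau> * R / (V * LB)))"
        using R LB P3_V P6_tau by simp
      also have "\<dots> \<le> exp t" unfolding t_def by simp
      finally show ?thesis .
    qed simp
    have "real m + 1 \<le> exp (real sz)"
      using exp_ge_add_one_self[of "real sz"] dim_le_size by linarith
    moreover have "K \<le> exp Q"
      using P5_size Q P5_K by (metis exp_le_cancel_iff exp_ln order_trans)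
    moreover have "1 / \<epsilon> \<le> exp s"
      using s_ge exp_ge_add_one_self[of s] by linarith
    ultimately have "(R / LB) * (real m + 1) * K * (1 / \<epsilon>) \<le> exp t * exp (real sz) * exp Q * exp s"
      using RLB R_nonneg LB P5_K \<epsilon> by (intro mult_mono) auto
    then have "R * (real m + 1) * K / (\<epsilon> * LB) \<le> exp E"
      unfolding E_def by (simp add: exp_add mult_ac)
    moreover have "1 \<le> exp E" using E0 by simp
    ultimately have "R * (real m + 1) * K / (\<epsilon> * LB) + 1 \<le> 2 * exp E" by linarith
    also have "\<dots> \<le> exp 1 * exp E"
      using exp_ge_add_one_self[of 1] by (intro mult_right_mono) auto
    finally have "R * (real m + 1) * K / (\<epsilon> * LB) + 1 \<le> exp (E + 1)"
      by (simp add: exp_add mult.commute)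
    then have "(R * (real m + 1) * K / (\<epsilon> * LB) + 1) ^ m \<le> exp (E + 1) ^ m"
      using R_nonneg P5_K LB \<epsilon> by (intro power_mono) auto
    then show ?thesis by (simp add: exp_of_nat_mult)
  qed
  have grid_le: "lam / \<epsilon>\<^sup>2 + 2 \<le> exp (s\<^sup>2 + 1)"
  proof -
    have "lam / \<epsilon>\<^sup>2 \<le> lam\<^sup>2 / \<epsilon>\<^sup>2"
      using P2_lambda by (intro divide_right_mono) (auto simp: power2_eq_square)
    then show ?thesis
      using exp_ge_add_one_self[of "s\<^sup>2 + 1"] unfolding s_def by (simp add: power_divide)
  qed
  have rate: "1 / s ^ 4 \<le> (\<epsilon>\<^sup>2 / lam)\<^sup>2"
  proof -
    have "1 / s\<^sup>2 = \<epsilon>\<^sup>2 / lam\<^sup>2" unfolding s_def by (simp add: power_divide)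
    also have "\<dots> \<le> \<epsilon>\<^sup>2 / lam"
      using P2_lambda by (intro divide_left_mono) (auto simp: power2_eq_square)
    finally have "(1 / s\<^sup>2)\<^sup>2 \<le> (\<epsilon>\<^sup>2 / lam)\<^sup>2" by (intro power_mono) auto
    then show ?thesis by (simp add: power_divide flip: power_mult)
  qed
  have exponent: "2 * s * u + real m * (E + 1) + (s\<^sup>2 + 1) + u \<le> 2 * real N * (\<epsilon>\<^sup>2 / lam)\<^sup>2"
  proof -
    have TT: "T \<le> T\<^sup>2" using T(1) by (simp add: power2_eq_square)
    have "s * u \<le> T * T" using T s0 u0 by (intro mult_mono) auto
    then have 1: "2 * s * u \<le> 2 * T\<^sup>2" by (simp add: power2_eq_square)
    have "real m * (E + 1) \<le> T * (T + Q)"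
      using T dim_le_size E0 Q unfolding E_def by (intro mult_mono) auto
    then have 2: "real m * (E + 1) \<le> T\<^sup>2 + a * T ^ (d + 1)"
      unfolding Q_def by (simp add: power2_eq_square algebra_simps)
    have "s\<^sup>2 + 1 \<le> (1 + s)\<^sup>2" using s0 by (simp add: power2_eq_square algebra_simps)
    also have "\<dots> \<le> T\<^sup>2" using T s0 by (intro power_mono) auto
    finally have 3: "s\<^sup>2 + 1 \<le> T\<^sup>2" .
    \<comment> \<open>The coefficient \<open>5\<close> collects \<open>2\<close> from the number of
      batches and \<open>1\<close> each from the net, the grid and the term
      \<open>u\<close>.\<close>
    have "2 * s * u + real m * (E + 1) + (s\<^sup>2 + 1) + u \<le> 5 * T\<^sup>2 + a * T ^ (d + 1)"
      using 1 2 3 T(4) TT by linarith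
    also have "\<dots> \<le> 5 * T ^ (d + 2) + a * T ^ (d + 2)"
      using T(1) a by (intro add_mono mult_left_mono power_increasing) auto
    also have "\<dots> = (5 + a) * T ^ (d + 6) * (1 / T ^ 4)"
    proof -
      have "T ^ (d + 6) = T ^ (d + 2) * T ^ 4" using power_add[of T "d + 2" 4] by (simp add: add.commute)
      then show ?thesis using T(1) by (simp add: distrib_right add_divide_distrib)
    qed
    also have "\<dots> \<le> real N * (1 / s ^ 4)"
      using N T(1,2) s0 a unfolding T_def s_def t_def u_def
      by (intro mult_mono divide_left_mono power_mono mult_pos_pos) auto
    also have "\<dots> \<le> real N * (\<epsilon>\<^sup>2 / lam)\<^sup>2"
      using rate by (intro mult_left_mono) auto
    also have "\<dots> \<le> 2 * real N * (\<epsilon>\<^sup>2 / lam)\<^sup>2" by simp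
    finally show ?thesis .
  qed
  have "real k * (R * (real m + 1) * K / (\<epsilon> * LB) + 1) ^ m * (lam / \<epsilon>\<^sup>2 + 2)
      * exp (- 2 * real N * (\<epsilon>\<^sup>2 / lam)\<^sup>2)
    \<le> exp (2 * s * u) * exp (real m * (E + 1)) * exp (s\<^sup>2 + 1) * exp (- 2 * real N * (\<epsilon>\<^sup>2 / lam)\<^sup>2)"
    using k_le net_le grid_le R_nonneg P5_K LB \<epsilon> P2_lambda
    by (intro mult_right_mono mult_mono) auto
  also have "\<dots> = exp (2 * s * u + real m * (E + 1) + (s\<^sup>2 + 1) - 2 * real N * (\<epsilon>\<^sup>2 / lam)\<^sup>2)"
    by (simp add: exp_add exp_diff exp_minus field_simps)
  also have "\<dots> \<le> exp (- u)" using exponent by simp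
  also have "\<dots> = \<delta>" unfolding u_def using \<delta> by (simp add: ln_div)
  finally show ?thesis .
qed

end

text \<open>Absolute values handle negative coefficients, and \<open>1 + x \<ge> 1\<close> lets the
  top power dominate the lower ones.\<close>

lemma poly_le_monomial:
  fixes q :: "real poly"
  obtains a d where "0 \<le> a" "\<And>x. 0 \<le> x \<Longrightarrow> poly q x \<le> a * (1 + x) ^ d"
proof
  let ?a = "\<Sum>i\<le>degree q. \<bar>coeff q i\<bar>"
  show "0 \<le> ?a" by (simp add: sum_nonneg)
  fix x :: real assume x: "0 \<le> x"
  have "poly q x \<le> (\<Sum>i\<le>degree q. \<bar>coeff q i\<bar> * (1 + x) ^ degree q)"
    unfolding poly_altdef
  proof (rule sum_mono)
    fix i assume "i \<in> {..degree q}"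
    then have "x ^ i \<le> (1 + x) ^ degree q"
      using x power_mono[of x "1 + x" i] power_increasing[of i "degree q" "1 + x"] by simp
    then show "coeff q i * x ^ i \<le> \<bar>coeff q i\<bar> * (1 + x) ^ degree q"
      using x by (intro mult_mono) auto
  qed
  then show "poly q x \<le> ?a * (1 + x) ^ degree q" by (simp add: sum_distrib_right)
qed

theorem theorem3p17:
  shows "\<exists>C::real. 0 < C \<and> (\<forall>q :: real poly. \<exists>N. poly_sample_size N \<and>
    (\<forall>(\<A> :: 'a set) m P c g \<kappa>sc r lam R V K \<tau> sz (pstar :: 'a pmf) LB \<epsilon> \<kappa> \<delta> \<beta> \<rho>.
       dr_two_stage \<A> m P c g \<kappa>sc r lam R V K \<tau> sz q \<longrightarrow>
       set_pmf pstar \<subseteq> \<A> \<longrightarrow>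
       0 < LB \<longrightarrow>
       (\<forall>p. set_pmf p \<subseteq> \<A> \<longrightarrow> LB \<le> (INF x\<in>P. h_val \<A> c g \<kappa>sc r p x)) \<longrightarrow>
       0 < \<epsilon> \<longrightarrow> \<epsilon> \<le> 1 / 3 \<longrightarrow> (0::real) < \<kappa> \<longrightarrow> 0 < \<delta> \<longrightarrow> \<delta> < 1 \<longrightarrow> 1 \<le> \<beta> \<longrightarrow> 1 \<le> \<rho> \<longrightarrow>
       (let n = N (lam / \<epsilon>) (ln (\<tau> * R / (V * LB))) (ln (1 / \<delta>)) sz;
            k = nat \<lceil>2 / \<epsilon> * ln (1 / \<delta>)\<rceil>
        in measure_pmf.prob (sample_batches k n pstar)
             {\<omega>. \<forall>xbar fbar j.
                (\<forall>i\<in>{1..k}. xbar i \<in> P \<and>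
                   h_val \<A> c g \<kappa>sc r (empirical n \<omega> i) (xbar i) \<le> \<beta> * fbar i \<and>
                   fbar i \<le> \<rho> * (INF x\<in>P. h_val \<A> c g \<kappa>sc r (empirical n \<omega> i) x)) \<longrightarrow>
                j \<in> {1..k} \<longrightarrow> (\<forall>i\<in>{1..k}. fbar j \<le> fbar i) \<longrightarrow>
                h_val \<A> c g \<kappa>sc r pstar (xbar j)
                  \<le> 4 * \<beta> * \<rho> * (1 + C * \<epsilon>) * (INF x\<in>P. h_val \<A> c g \<kappa>sc r pstar x)}
           \<ge> 1 - 3 * \<delta>)))"
proof (rule exI[of _ 2], intro conjI allI, goal_cases)
  case 1
  show ?case by simp
next
  case (2 q)
  obtain a d where a: "0 \<le> a" and poly: "\<And>x. 0 \<le> x \<Longrightarrow> poly q x \<le> a * (1 + x) ^ d"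
    using poly_le_monomial[of q] by blast
  \<comment> \<open>\<open>N\<close> depends on \<open>q\<close> only through \<open>a\<close> and
    \<open>d\<close>, so it is fixed before the instance. Rounding up adds less than 1, which
    raising \<open>5 + a\<close> to \<open>6 + a\<close> absorbs.\<close>
  define N :: "real \<Rightarrow> real \<Rightarrow> real \<Rightarrow> nat \<Rightarrow> nat"
    where "N s t u n = nat \<lceil>(5 + a) * (1 + s + max 0 t + u + real n) ^ (d + 6)\<rceil>" for s t u n
  have N_bounds: "1 \<le> N s t u n" "(5 + a) * (1 + s + max 0 t + u + real n) ^ (d + 6) \<le> real (N s t u n)"
      "real (N s t u n) \<le> (6 + a) * (1 + s + max 0 t + u + real n) ^ (d + 6)"
    if "0 \<le> s" "0 \<le> u" for s t u n
  proof -
    define T where "T = (1 + s + max 0 t + u + real n) ^ (d + 6)"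
    have T: "1 \<le> T" unfolding T_def using that by (intro one_le_power) simp
    then have "1 * 1 \<le> (5 + a) * T" using a by (intro mult_mono) auto
    moreover have "(6 + a) * T = (5 + a) * T + T" by (simp add: algebra_simps)
    moreover have "real (N s t u n) = of_int \<lceil>(5 + a) * T\<rceil>"
      unfolding N_def T_def[symmetric] using \<open>1 * 1 \<le> (5 + a) * T\<close> by simp
    ultimately have "1 \<le> real (N s t u n)" "(5 + a) * T \<le> real (N s t u n)" "real (N s t u n) \<le> (6 + a) * T"
      using T by linarith+
    then show "1 \<le> N s t u n" "(5 + a) * (1 + s + max 0 t + u + real n) ^ (d + 6) \<le> real (N s t u n)"
      "real (N s t u n) \<le> (6 + a) * (1 + s + max 0 t + u + real n) ^ (d + 6)"
      unfolding T_def by simp_all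
  qed
  show ?case
  proof (intro exI[of _ N] conjI allI impI, goal_cases)
    case 1
    show ?case unfolding poly_sample_size_def using N_bounds(1,3) by blast
  next
    case (2 \<A> m P c g \<kappa>sc r lam R V K \<tau> sz pstar LB \<epsilon> \<kappa> \<delta> \<beta> \<rho>)
    interpret dr_two_stage \<A> m P c g \<kappa>sc r lam R V K \<tau> sz q by (rule 2(1))
    have nonneg: "0 \<le> lam / \<epsilon>" "0 \<le> ln (1 / \<delta>)" using P2_lambda 2 by auto
    note n_bounds = N_bounds[OF nonneg]
    \<comment> \<open>Two bad events of probability at most \<open>\<delta>\<close> each already
      leave \<open>1 - 2 * \<delta>\<close>.\<close>
    have "1 - 3 * \<delta> \<le> 1 - 2 * \<delta>" using 2 by simp
    also note success_probability[OF 2(2,3) 2(4)[rule_format, OF 2(2)] 2(5,6,8,9,10,11) n_bounds(1) refl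
        sample_size_sufficient[OF a poly 2(3,5,6,8,9) refl n_bounds(2)]]
    finally show ?case by (simp add: Let_def)
  qed
qed

end
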